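(* Let $k\geq 2$. (1) The oriented de Bruijn graphs $\vec{B}_{k,N}$, regarded as unlabeled oriented graphs, converge as $N\to\infty$ in the sense of Benjamini–Schramm to the oriented Cayley graph $\vec{\mathrm{Cay}}(\mathcal L_k,X_k)$. (2) Regarding all graphs as unlabeled oriented graphs and all convergences in the sense of Benjamini–Schramm, the following hold and are compatible (the corresponding diagram of limits commutes): for every fixed $M\in\{1,2,\dots\}$, $\vec{SW}_{k,N,M}\to\vec{\mathrm{Cay}}(\mathcal L_k,X_k)$ as $N\to\infty$; for every fixed $N\geq 0$, $\vec{SW}_{k,N,M}\to\vec{SW}_{k,N,\infty}$ as $M\to\infty$; $\vec{SW}_{k,N,\infty}\to\vec{\mathrm{Cay}}(\mathcal L_k,X_k)$ as $N\to\infty$; and $\vec{SW}_{k,N,M}\to\vec{\mathrm{Cay}}(\mathcal L_k,X_k)$ as $N,M\to\infty$ simultaneously.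
   Context: Graphs may have loops and multiple edges. An oriented graph consists of a vertex set $V$, an edge set $E$ and maps $\iota,\tau\colon E\to V$ (initial and terminal vertex). Fix $k\geq 2$. For $N\in\{0,1,2,\dots\}$ and $M\in\{1,2,\dots\}\cup\{\infty\}$, the oriented spider-web graph $\vec{SW}_{k,N,M}$ is the oriented graph with vertex set $\{0,\dots,k-1\}^N\times\mathbb Z/M\mathbb Z$ (where $\mathbb Z/\infty\mathbb Z:=\mathbb Z$) in which each vertex $(x_1\dots x_N,i)$ has exactly $k$ outgoing edges, labeled $R_0,\dots,R_{k-1}$, the one labeled $R_y$ ending at $(x_2\dots x_Ny,\,i+1)$. The oriented de Bruijn graph $\vec B_{k,N}$ is $\vec{SW}_{k,N,1}$ (vertex set $\{0,\dots,k-1\}^N$, an edge labeled $R_y$ from $x_1\dots x_N$ to $x_2\dots x_Ny$). The lamplighter group is $\mathcal L_k=(\mathbb Z/k\mathbb Z)\wr\mathbb Z=(\bigoplus_{\mathbb Z}\mathbb Z/k\mathbb Z)\rtimes\mathbb Z$, where the generator $b$ of $\mathbb Z$ acts by shifting coordinates; $c$ denotes the generator of the copy of $\mathbb Z/k\mathbb Z$ at coordinate $0$. Let $\bar c_r=c^rb$ for $0\le r\le k-1$ and $X_k=\{\bar c_0,\dots,\bar c_{k-1}\}$. The oriented Cayley graph $\vec{\mathrm{Cay}}(\mathcal L_k,X_k)$ has vertex set $\mathcal L_k$ and an edge from $g$ to $gx$ for each $x\in X_k$. Space of rooted graphs: isomorphism classes of connected rooted oriented graphs, with distance $1/(1+r)$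 where $r$ is the largest radius for which the balls of radius $r$ (in the underlying non-oriented graphs, with orientation kept) around the roots are isomorphic as rooted oriented graphs. For a finite graph $\Gamma$, $\lambda_\Gamma$ is the law of the connected component of a uniformly random root; a sequence $\Gamma_n$ converges in the sense of Benjamini–Schramm to a graph $\Gamma$ whose rooted versions are all isomorphic (vertex-transitive) if $\lambda_{\Gamma_n}$ converges weakly to the Dirac mass at $(\Gamma,v)$; the graphs $\vec{SW}_{k,N,\infty}$ are vertex-transitive, and for them the associated measure is the Dirac mass at the graph rooted at any vertex. *)

theory Defs
  imports
    "HOL-Probability.Probability"
    "HOL-Algebra.Elementary_Groups"
    "HOL-Algebra.Product_Groups"
    "Graph_Theory.Digraph_Isomorphism"
begin

section \<open>Rooted oriented graphs\<close>

text \<open>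
  An oriented graph is a \<^type>\<open>pre_digraph\<close> satisfying \<^locale>\<open>wf_digraph\<close>:
  \<^const>\<open>tail\<close> and \<^const>\<open>head\<close> are the initial and terminal vertex of an arc; loops and
  parallel arcs are allowed.
\<close>

definition locally_finite :: "('v, 'e) pre_digraph \<Rightarrow> bool" where
  "locally_finite G \<longleftrightarrow> (\<forall>v \<in> verts G. finite (out_arcs G v) \<and> finite (in_arcs G v))"

definition rooted_graph :: "('v, 'e) pre_digraph \<Rightarrow> 'v \<Rightarrow> bool" where
  "rooted_graph G v \<longleftrightarrow>
     wf_digraph G \<and> locally_finite G \<and> Digraph_Component.connected G \<and> v \<in> verts G"

definition rooted_iso ::
    "('v, 'e) pre_digraph \<Rightarrow> 'v \<Rightarrow> ('w, 'f) pre_digraph \<Rightarrow> 'w \<Rightarrow> bool" where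
  "rooted_iso G v H w \<longleftrightarrow>
     (\<exists>h. pre_digraph.digraph_isomorphism G h \<and> H = app_iso h G \<and> iso_verts h v = w)"

text \<open>
  The ball of radius \<open>r\<close> consists of all paths of length at most \<open>r\<close> starting at the root in the
  underlying non-oriented graph: its vertices are those at distance at most \<open>r\<close>, its arcs those
  with an endpoint at distance less than \<open>r\<close>. In particular a ball of radius \<open>0\<close> is a single vertex
  without loops, so any two rooted graphs have isomorphic balls of radius \<open>0\<close>, and the
  largest radius with isomorphic balls always makes sense (in the subgraph induced by the
  vertices at distance at most \<open>r\<close>, loops at the root would already be visible at radius \<open>0\<close>).
\<close>

definition ball_verts :: "('v, 'e) pre_digraph \<Rightarrow> 'v \<Rightarrow> nat \<Rightarrow> 'v set" where
  "ball_verts G v r = {w. \<exists>n \<le> r. (v, w) \<in> parcs (mk_symmetric G) ^^ n}"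

definition rooted_ball :: "('v, 'e) pre_digraph \<Rightarrow> 'v \<Rightarrow> nat \<Rightarrow> ('v, 'e) pre_digraph" where
  "rooted_ball G v r =
     \<lparr>verts = ball_verts G v r,
      arcs = {e \<in> arcs G. \<exists>s < r. tail G e \<in> ball_verts G v s \<or> head G e \<in> ball_verts G v s},
      tail = tail G,
      head = head G\<rparr>"

definition balls_iso ::
    "('v, 'e) pre_digraph \<Rightarrow> 'v \<Rightarrow> ('w, 'f) pre_digraph \<Rightarrow> 'w \<Rightarrow> nat \<Rightarrow> bool" where
  "balls_iso G v H w r \<longleftrightarrow> rooted_iso (rooted_ball G v r) v (rooted_ball H w r) w"

definition component :: "('v, 'e) pre_digraph \<Rightarrow> 'v \<Rightarrow> ('v, 'e) pre_digraph" where
  "component G v = G \<restriction> {w. v \<rightarrow>\<^sup>*\<^bsub>mk_symmetric G\<^esub> w}"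


subsection \<open>Isomorphisms as pairs of maps\<close>

definition iso_maps ::
    "('v \<Rightarrow> 'w) \<Rightarrow> ('e \<Rightarrow> 'f) \<Rightarrow> ('v, 'e) pre_digraph \<Rightarrow> 'v \<Rightarrow> ('w, 'f) pre_digraph \<Rightarrow> 'w \<Rightarrow> bool"
  where
  "iso_maps f g G v H w \<longleftrightarrow>
     bij_betw f (verts G) (verts H) \<and> bij_betw g (arcs G) (arcs H) \<and>
     (\<forall>e \<in> arcs G. f (tail G e) = tail H (g e) \<and> f (head G e) = head H (g e)) \<and> f v = w"

lemma rooted_iso_iff:
  fixes G :: "('v, 'e) pre_digraph" and H :: "('w, 'f) pre_digraph"
  shows "rooted_iso G v H w \<longleftrightarrow> wf_digraph G \<and> (\<exists>f g. iso_maps f g G v H w)"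
proof
  assume "rooted_iso G v H w"
  then obtain h where "pre_digraph.digraph_isomorphism G h" "H = app_iso h G" "iso_verts h v = w"
    unfolding rooted_iso_def by blast
  then have "wf_digraph G" "iso_maps (iso_verts h) (iso_arcs h) G v H w"
    by (auto simp: iso_maps_def pre_digraph.digraph_isomorphism_def bij_betw_def)
  then show "wf_digraph G \<and> (\<exists>f g. iso_maps f g G v H w)" by blast
next
  assume *: "wf_digraph G \<and> (\<exists>f g. iso_maps f g G v H w)"
  then obtain f g where fg: "iso_maps f g G v H w" by blast
  let ?h = "\<lparr>iso_verts = f, iso_arcs = g, iso_head = head H, iso_tail = tail H\<rparr>"
  have "pre_digraph.digraph_isomorphism G ?h"
    using * fg by (auto simp: iso_maps_def pre_digraph.digraph_isomorphism_def bij_betw_def)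
  moreover have "H = app_iso ?h G"
    using fg by (auto simp: iso_maps_def app_iso_def bij_betw_def)
  ultimately show "rooted_iso G v H w"
    using fg unfolding rooted_iso_def iso_maps_def by (intro exI[of _ ?h]) auto
qed

lemma iso_maps_refl: "iso_maps id id G v G v"
  by (auto simp: iso_maps_def)

lemma iso_maps_wf:
  assumes "iso_maps f g G v H w" "wf_digraph G"
  shows "wf_digraph H"
proof
  interpret wf_digraph G by fact
  fix e assume "e \<in> arcs H"
  moreover have "g ` arcs G = arcs H" using assms(1) by (auto simp: iso_maps_def bij_betw_def)
  ultimately obtain e' where "e' \<in> arcs G" "e = g e'" by blast
  moreover have "f ` verts G = verts H" using assms(1) by (auto simp: iso_maps_def bij_betw_def)
  ultimately show "tail H e \<in> verts H" "head H e \<in> verts H"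
    using assms(1) unfolding iso_maps_def by (metis imageI tail_in_verts, metis imageI head_in_verts)
qed

lemma iso_maps_sym:
  assumes "iso_maps f g G v H w" "wf_digraph G" "v \<in> verts G"
  shows "iso_maps (the_inv_into (verts G) f) (the_inv_into (arcs G) g) H w G v"
proof -
  interpret wf_digraph G by fact
  have f: "bij_betw f (verts G) (verts H)" and g: "bij_betw g (arcs G) (arcs H)"
    using assms by (auto simp: iso_maps_def)
  let ?f = "the_inv_into (verts G) f" and ?g = "the_inv_into (arcs G) g"
  have ff: "?f (f x) = x" if "x \<in> verts G" for x
    using f that by (simp add: bij_betw_def the_inv_into_f_f)
  have "?f (tail H e) = tail G (?g e) \<and> ?f (head H e) = head G (?g e)" if e: "e \<in> arcs H" for e
  proof -
    obtain e' where e': "e' \<in> arcs G" "e = g e'" using e g by (auto simp: bij_betw_def)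
    have "?g e = e'" using e' g by (simp add: bij_betw_def the_inv_into_f_f)
    moreover have "tail H e = f (tail G e')" "head H e = f (head G e')"
      using assms(1) e' by (auto simp: iso_maps_def)
    ultimately show ?thesis using ff e' by simp
  qed
  moreover have "?f w = v" using assms ff by (auto simp: iso_maps_def)
  ultimately show ?thesis
    using f g by (auto simp: iso_maps_def intro: bij_betw_the_inv_into)
qed

lemma iso_maps_trans:
  assumes "iso_maps f g G v H w" "iso_maps f' g' H w K x"
  shows "iso_maps (f' \<circ> f) (g' \<circ> g) G v K x"
proof -
  have "g e \<in> arcs H" if "e \<in> arcs G" for e
    using assms(1) that by (auto simp: iso_maps_def bij_betw_def)
  then show ?thesis
    using assms by (auto simp: iso_maps_def intro: bij_betw_trans)
qed

lemma rooted_iso_refl: "wf_digraph G \<Longrightarrow> rooted_iso G v G v"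
  unfolding rooted_iso_iff by (intro conjI exI, assumption, rule iso_maps_refl)

lemma rooted_iso_wf: "rooted_iso G v H w \<Longrightarrow> wf_digraph G \<and> wf_digraph H"
  by (auto simp: rooted_iso_iff intro: iso_maps_wf)

lemma rooted_iso_sym: "rooted_iso G v H w \<Longrightarrow> v \<in> verts G \<Longrightarrow> rooted_iso H w G v"
  by (meson rooted_iso_iff iso_maps_sym rooted_iso_wf)

lemma rooted_iso_trans: "rooted_iso G v H w \<Longrightarrow> rooted_iso H w K x \<Longrightarrow> rooted_iso G v K x"
  by (meson rooted_iso_iff iso_maps_trans)


subsection \<open>Balls and isomorphisms\<close>

lemma adj_iff:
  "(x, y) \<in> parcs (mk_symmetric G) \<longleftrightarrow>
     (\<exists>e \<in> arcs G. (tail G e = x \<and> head G e = y) \<or> (tail G e = y \<and> head G e = x))"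
  by (auto simp: parcs_mk_symmetric)

lemma root_in_ball [simp]: "v \<in> ball_verts G v r"
  by (auto simp: ball_verts_def intro!: exI[of _ 0])

lemma ball_verts_0 [simp]: "ball_verts G v 0 = {v}"
  by (auto simp: ball_verts_def)

lemma ball_verts_mono: "r \<le> s \<Longrightarrow> ball_verts G v r \<subseteq> ball_verts G v s"
  unfolding ball_verts_def using le_trans by blast

lemma ball_verts_Suc:
  "ball_verts G v (Suc r) =
     ball_verts G v r \<union> {y. \<exists>x \<in> ball_verts G v r. (x, y) \<in> parcs (mk_symmetric G)}"
  (is "?L = ?R")
proof
  show "?L \<subseteq> ?R"
  proof
    fix y assume "y \<in> ?L"
    then obtain n where n: "n \<le> Suc r" "(v, y) \<in> parcs (mk_symmetric G) ^^ n"
      by (auto simp: ball_verts_def)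
    show "y \<in> ?R"
    proof (cases n)
      case 0
      then show ?thesis using n by auto
    next
      case (Suc m)
      then obtain x where "(v, x) \<in> parcs (mk_symmetric G) ^^ m" "(x, y) \<in> parcs (mk_symmetric G)"
        using n by auto
      then show ?thesis using Suc n by (auto simp: ball_verts_def)
    qed
  qed
  have "y \<in> ?L" if "x \<in> ball_verts G v r" "(x, y) \<in> parcs (mk_symmetric G)" for x y
  proof -
    obtain n where "n \<le> r" "(v, x) \<in> parcs (mk_symmetric G) ^^ n"
      using \<open>x \<in> ball_verts G v r\<close> by (auto simp: ball_verts_def)
    then have "(v, y) \<in> parcs (mk_symmetric G) ^^ Suc n" "Suc n \<le> Suc r"
      using that(2) by auto
    then show ?thesis unfolding ball_verts_def by blast
  qed
  then show "?R \<subseteq> ?L" using ball_verts_mono[of r "Suc r" G v] by auto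
qed

lemma ball_verts_subset:
  assumes "wf_digraph G" "v \<in> verts G"
  shows "ball_verts G v r \<subseteq> verts G"
proof (induction r)
  case (Suc r)
  then show ?case using assms(1) by (auto simp: ball_verts_Suc adj_iff wf_digraph_def)
qed (use assms in auto)

lemma ball_verts_step:
  assumes "e \<in> arcs G"
  shows "tail G e \<in> ball_verts G v r \<Longrightarrow> head G e \<in> ball_verts G v (Suc r)"
    and "head G e \<in> ball_verts G v r \<Longrightarrow> tail G e \<in> ball_verts G v (Suc r)"
  using assms by (auto simp: ball_verts_Suc adj_iff)

lemma rooted_ball_sel [simp]:
  "verts (rooted_ball G v r) = ball_verts G v r"
  "tail (rooted_ball G v r) = tail G"
  "head (rooted_ball G v r) = head G"
  by (auto simp: rooted_ball_def)

lemma arcs_rooted_ball: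
  "arcs (rooted_ball G v r) =
     {e \<in> arcs G. \<exists>s < r. tail G e \<in> ball_verts G v s \<or> head G e \<in> ball_verts G v s}"
  by (auto simp: rooted_ball_def)

lemma wf_rooted_ball: "wf_digraph (rooted_ball G v r)"
proof
  fix e assume e: "e \<in> arcs (rooted_ball G v r)"
  then obtain s where s: "s < r" "e \<in> arcs G" "tail G e \<in> ball_verts G v s \<or> head G e \<in> ball_verts G v s"
    by (auto simp: arcs_rooted_ball)
  then have "tail G e \<in> ball_verts G v (Suc s) \<and> head G e \<in> ball_verts G v (Suc s)"
    using ball_verts_step[of e G v s] by (auto simp: ball_verts_Suc)
  then show "tail (rooted_ball G v r) e \<in> verts (rooted_ball G v r)"
    "head (rooted_ball G v r) e \<in> verts (rooted_ball G v r)"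
    using ball_verts_mono[of "Suc s" r G v] s by auto
qed

lemma ball_verts_rooted_ball:
  assumes "s \<le> r"
  shows "ball_verts (rooted_ball G v r) v s = ball_verts G v s"
  using assms
proof (induction s)
  case (Suc s)
  have "(x, y) \<in> parcs (mk_symmetric (rooted_ball G v r)) \<longleftrightarrow> (x, y) \<in> parcs (mk_symmetric G)"
    if "x \<in> ball_verts G v s" for x y
  proof -
    have "s < r" using Suc.prems by simp
    then have "e \<in> arcs (rooted_ball G v r) \<longleftrightarrow> e \<in> arcs G" if "tail G e = x \<or> head G e = x" for e
      using that \<open>x \<in> ball_verts G v s\<close> unfolding arcs_rooted_ball by blast
    then show ?thesis unfolding adj_iff rooted_ball_sel by blast
  qed
  then show ?case using Suc by (auto simp: ball_verts_Suc)
qed simp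

lemma rooted_ball_rooted_ball:
  assumes "s \<le> r"
  shows "rooted_ball (rooted_ball G v r) v s = rooted_ball G v s"
proof -
  have "arcs (rooted_ball (rooted_ball G v r) v s) = arcs (rooted_ball G v s)"
  proof (intro Set.set_eqI)
    fix e
    have "e \<in> arcs (rooted_ball (rooted_ball G v r) v s) \<longleftrightarrow>
        e \<in> arcs (rooted_ball G v r) \<and>
        (\<exists>t < s. tail G e \<in> ball_verts G v t \<or> head G e \<in> ball_verts G v t)"
      using assms ball_verts_rooted_ball[of _ r G v] by (auto simp: arcs_rooted_ball[of "rooted_ball G v r"])
    also have "\<dots> \<longleftrightarrow> e \<in> arcs (rooted_ball G v s)"
      using assms less_le_trans unfolding arcs_rooted_ball by blast
    finally show "e \<in> arcs (rooted_ball (rooted_ball G v r) v s) \<longleftrightarrow> e \<in> arcs (rooted_ball G v s)" .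
  qed
  moreover have "verts (rooted_ball (rooted_ball G v r) v s) = verts (rooted_ball G v s)"
    using assms by (simp add: ball_verts_rooted_ball)
  ultimately show ?thesis by (auto intro: pre_digraph.equality)
qed

lemma iso_maps_ball_image_subset:
  assumes "iso_maps f g G v H w" "x \<in> ball_verts G v r"
  shows "f x \<in> ball_verts H w r"
  using assms(2)
proof (induction r arbitrary: x)
  case 0
  then show ?case using assms(1) by (auto simp: iso_maps_def)
next
  case (Suc r)
  then consider "x \<in> ball_verts G v r"
    | y where "y \<in> ball_verts G v r" "(y, x) \<in> parcs (mk_symmetric G)"
    by (auto simp: ball_verts_Suc)
  then show ?case
  proof cases
    case 1
    then show ?thesis using Suc.IH by (auto simp: ball_verts_Suc)
  next
    case 2
    then obtain e where e: "e \<in> arcs G"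
      "(tail G e = y \<and> head G e = x) \<or> (tail G e = x \<and> head G e = y)"
      by (auto simp: adj_iff)
    have ge: "g e \<in> arcs H" using assms(1) e by (auto simp: iso_maps_def bij_betw_def)
    have "f (tail G e) = tail H (g e)" "f (head G e) = head H (g e)"
      using assms(1) e by (auto simp: iso_maps_def)
    then have "(f y, f x) \<in> parcs (mk_symmetric H)" using e ge unfolding adj_iff by auto
    then show ?thesis using Suc.IH[OF 2(1)] by (auto simp: ball_verts_Suc)
  qed
qed

lemma iso_maps_ball:
  assumes iso: "iso_maps f g G v H w" and wf: "wf_digraph G" and v: "v \<in> verts G"
  shows "iso_maps f g (rooted_ball G v r) v (rooted_ball H w r) w"
proof -
  let ?f = "the_inv_into (verts G) f"
  have wfH: "wf_digraph H" by (rule iso_maps_wf[OF iso wf])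
  have w: "w \<in> verts H" using iso v by (auto simp: iso_maps_def bij_betw_def)
  have f: "bij_betw f (verts G) (verts H)" and g: "bij_betw g (arcs G) (arcs H)"
    using iso by (auto simp: iso_maps_def)
  have im: "f x \<in> ball_verts H w s \<longleftrightarrow> x \<in> ball_verts G v s" if "x \<in> verts G" for x s
    using iso_maps_ball_image_subset[OF iso] iso_maps_ball_image_subset[OF iso_maps_sym[OF iso wf v], of "f x" s]
      that f by (auto simp: bij_betw_def the_inv_into_f_f)
  have "bij_betw f (ball_verts G v r) (ball_verts H w r)"
  proof -
    have "inj_on f (ball_verts G v r)"
      using f ball_verts_subset[OF wf v] by (auto simp: bij_betw_def intro: inj_on_subset)
    moreover have "f ` ball_verts G v r = ball_verts H w r"
    proof
      show "f ` ball_verts G v r \<subseteq> ball_verts H w r"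
        using iso_maps_ball_image_subset[OF iso] by auto
      show "ball_verts H w r \<subseteq> f ` ball_verts G v r"
      proof
        fix y assume y: "y \<in> ball_verts H w r"
        then have "y \<in> verts H" using ball_verts_subset[OF wfH w] by auto
        then obtain x where "x \<in> verts G" "y = f x" using f by (auto simp: bij_betw_def)
        then show "y \<in> f ` ball_verts G v r" using im y by auto
      qed
    qed
    ultimately show ?thesis by (simp add: bij_betw_def)
  qed
  moreover have "bij_betw g (arcs (rooted_ball G v r)) (arcs (rooted_ball H w r))"
  proof -
    have mem: "g e \<in> arcs (rooted_ball H w r) \<longleftrightarrow> e \<in> arcs (rooted_ball G v r)" if e: "e \<in> arcs G" for e
    proof -
      have "tail H (g e) = f (tail G e)" "head H (g e) = f (head G e)" "g e \<in> arcs H"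
        using iso e by (auto simp: iso_maps_def bij_betw_def)
      moreover have "tail G e \<in> verts G" "head G e \<in> verts G"
        using wf e by (auto simp: wf_digraph_def)
      ultimately show ?thesis using im e by (simp add: arcs_rooted_ball)
    qed
    have sub: "arcs (rooted_ball G v r) \<subseteq> arcs G" "arcs (rooted_ball H w r) \<subseteq> arcs H"
      by (auto simp: arcs_rooted_ball)
    have "inj_on g (arcs (rooted_ball G v r))"
      using g sub by (auto simp: bij_betw_def intro: inj_on_subset)
    moreover have "g ` arcs (rooted_ball G v r) = arcs (rooted_ball H w r)"
    proof
      show "g ` arcs (rooted_ball G v r) \<subseteq> arcs (rooted_ball H w r)"
        using mem sub by blast
      show "arcs (rooted_ball H w r) \<subseteq> g ` arcs (rooted_ball G v r)"
      proof
        fix e' assume e': "e' \<in> arcs (rooted_ball H w r)"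
        then have "e' \<in> g ` arcs G" using sub g by (auto simp: bij_betw_def)
        then show "e' \<in> g ` arcs (rooted_ball G v r)" using mem e' by auto
      qed
    qed
    ultimately show ?thesis by (simp add: bij_betw_def)
  qed
  ultimately show ?thesis using iso by (auto simp: iso_maps_def arcs_rooted_ball)
qed

lemma iso_maps_ball_antimono:
  assumes "iso_maps f g (rooted_ball G v r) v (rooted_ball H w r) w" "s \<le> r"
  shows "iso_maps f g (rooted_ball G v s) v (rooted_ball H w s) w"
  using iso_maps_ball[OF assms(1) wf_rooted_ball, of s] assms(2)
  by (simp add: rooted_ball_rooted_ball)

lemma balls_iso_iff:
  "balls_iso G v H w r \<longleftrightarrow> (\<exists>f g. iso_maps f g (rooted_ball G v r) v (rooted_ball H w r) w)"
  by (auto simp: balls_iso_def rooted_iso_iff wf_rooted_ball)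

lemma balls_iso_antimono: "balls_iso G v H w r \<Longrightarrow> s \<le> r \<Longrightarrow> balls_iso G v H w s"
  using iso_maps_ball_antimono by (fastforce simp: balls_iso_iff)

lemma balls_iso_sym: "balls_iso G v H w r \<Longrightarrow> balls_iso H w G v r"
  unfolding balls_iso_def by (rule rooted_iso_sym) auto

lemma balls_iso_trans: "balls_iso G v H w r \<Longrightarrow> balls_iso H w K x r \<Longrightarrow> balls_iso G v K x r"
  unfolding balls_iso_def by (rule rooted_iso_trans)

lemma rooted_iso_imp_balls_iso:
  "rooted_iso G v H w \<Longrightarrow> v \<in> verts G \<Longrightarrow> balls_iso G v H w r"
  using iso_maps_ball by (fastforce simp: balls_iso_iff rooted_iso_iff)

lemma balls_iso_0: "balls_iso G v H w 0"
  unfolding balls_iso_iff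
  by (intro exI[of _ "\<lambda>_. w"] exI[of _ undefined]) (auto simp: iso_maps_def arcs_rooted_ball bij_betw_def)

lemma rooted_iso_locally_finite:
  assumes "rooted_iso G v H w" "locally_finite G"
  shows "locally_finite H"
proof -
  obtain f g where iso: "iso_maps f g G v H w" and wf: "wf_digraph G"
    using assms by (auto simp: rooted_iso_iff)
  have f: "bij_betw f (verts G) (verts H)" and g: "bij_betw g (arcs G) (arcs H)"
    using iso by (auto simp: iso_maps_def)
  show ?thesis unfolding locally_finite_def
  proof
    fix y assume "y \<in> verts H"
    then obtain x where x: "x \<in> verts G" "y = f x" using f by (auto simp: bij_betw_def)
    have eq: "tail H (g e) = f x \<longleftrightarrow> tail G e = x" "head H (g e) = f x \<longleftrightarrow> head G e = x"
      if "e \<in> arcs G" for e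
    proof -
      have "tail H (g e) = f (tail G e)" "head H (g e) = f (head G e)"
        using iso that by (auto simp: iso_maps_def)
      moreover have "tail G e \<in> verts G" "head G e \<in> verts G"
        using wf that by (auto simp: wf_digraph_def)
      ultimately show "tail H (g e) = f x \<longleftrightarrow> tail G e = x" "head H (g e) = f x \<longleftrightarrow> head G e = x"
        using f x by (auto simp: bij_betw_def inj_on_def)
    qed
    have arcsH: "arcs H = g ` arcs G" using g by (simp add: bij_betw_def)
    have "out_arcs H y \<subseteq> g ` out_arcs G x" "in_arcs H y \<subseteq> g ` in_arcs G x"
      using eq x by (auto simp: out_arcs_def in_arcs_def arcsH)
    then show "finite (out_arcs H y) \<and> finite (in_arcs H y)"
      using assms(2) x by (auto simp: locally_finite_def intro: finite_subset)
  qed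
qed

lemma reachable_iff_ball:
  assumes "wf_digraph G" "v \<in> verts G"
  shows "v \<rightarrow>\<^sup>*\<^bsub>mk_symmetric G\<^esub> w \<longleftrightarrow> (\<exists>r. w \<in> ball_verts G v r)"
proof -
  interpret pair_wf_digraph "mk_symmetric G"
    using assms(1) by (rule wf_digraph.wellformed_mk_symmetric)
  have "v \<rightarrow>\<^sup>*\<^bsub>mk_symmetric G\<^esub> w \<longleftrightarrow> (v, w) \<in> (parcs (mk_symmetric G))\<^sup>*"
    using reachable_conv'[of v w] assms(2) by simp
  also have "\<dots> \<longleftrightarrow> (\<exists>r. w \<in> ball_verts G v r)"
    by (auto simp: rtrancl_power ball_verts_def)
  finally show ?thesis .
qed

lemma connected_iff_ball:
  assumes "wf_digraph G" "v \<in> verts G"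
  shows "Digraph_Component.connected G \<longleftrightarrow> (\<forall>w \<in> verts G. \<exists>r. w \<in> ball_verts G v r)"
proof
  assume "Digraph_Component.connected G"
  then show "\<forall>w \<in> verts G. \<exists>r. w \<in> ball_verts G v r"
    using assms by (auto simp: connected_def strongly_connected_def simp flip: reachable_iff_ball)
next
  assume *: "\<forall>w \<in> verts G. \<exists>r. w \<in> ball_verts G v r"
  interpret S: pair_wf_digraph "mk_symmetric G"
    using assms(1) by (rule wf_digraph.wellformed_mk_symmetric)
  have r: "v \<rightarrow>\<^sup>*\<^bsub>mk_symmetric G\<^esub> w" if "w \<in> verts G" for w
    using * that assms by (simp add: reachable_iff_ball)
  have "u \<rightarrow>\<^sup>*\<^bsub>mk_symmetric G\<^esub> w" if "u \<in> verts G" "w \<in> verts G" for u w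
    using symmetric_reachable[OF symmetric_mk_symmetric r[OF that(1)]] r[OF that(2)]
    by (rule S.reachable_trans)
  then show "Digraph_Component.connected G"
    using assms(2) by (auto simp: connected_def strongly_connected_def)
qed

lemma rooted_iso_rooted_graph:
  assumes "rooted_iso G v H w" "rooted_graph G v"
  shows "rooted_graph H w"
proof -
  obtain f g where iso: "iso_maps f g G v H w" and wf: "wf_digraph G" and v: "v \<in> verts G"
    using assms by (auto simp: rooted_iso_iff rooted_graph_def)
  have wfH: "wf_digraph H" by (rule iso_maps_wf[OF iso wf])
  have w: "w \<in> verts H" using iso v by (auto simp: iso_maps_def bij_betw_def)
  have "Digraph_Component.connected H"
    unfolding connected_iff_ball[OF wfH w]
  proof
    fix y assume "y \<in> verts H"
    moreover have "f ` verts G = verts H" using iso by (auto simp: iso_maps_def bij_betw_def)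
    ultimately obtain x where x: "x \<in> verts G" "y = f x" by blast
    then obtain r where "x \<in> ball_verts G v r"
      using assms(2) connected_iff_ball[OF wf v] by (auto simp: rooted_graph_def)
    then show "\<exists>r. y \<in> ball_verts H w r" using iso_maps_ball_image_subset[OF iso] x by auto
  qed
  then show ?thesis
    using wfH w rooted_iso_locally_finite[OF assms(1)] assms(2) by (simp add: rooted_graph_def)
qed

lemma finite_ball:
  assumes "wf_digraph G" "locally_finite G" "v \<in> verts G"
  shows "finite (ball_verts G v r)" "finite (arcs (rooted_ball G v r))"
proof -
  have V: "finite (ball_verts G v r)" for r
  proof (induction r)
    case (Suc r)
    have "{y. \<exists>x \<in> ball_verts G v r. (x, y) \<in> parcs (mk_symmetric G)} \<subseteq>
        (\<Union>x \<in> ball_verts G v r. head G ` out_arcs G x \<union> tail G ` in_arcs G x)"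
      by (auto simp: adj_iff)
    moreover have "finite \<dots>"
      using Suc assms ball_verts_subset[OF assms(1,3), of r]
      by (auto simp: locally_finite_def)
    ultimately show ?case using Suc finite_subset unfolding ball_verts_Suc by blast
  qed simp
  then show "finite (ball_verts G v r)" .
  have "arcs (rooted_ball G v r) \<subseteq> (\<Union>x \<in> ball_verts G v r. out_arcs G x \<union> in_arcs G x)"
  proof
    fix e assume "e \<in> arcs (rooted_ball G v r)"
    then obtain s where "s < r" "e \<in> arcs G" "tail G e \<in> ball_verts G v s \<or> head G e \<in> ball_verts G v s"
      by (auto simp: arcs_rooted_ball)
    then show "e \<in> (\<Union>x \<in> ball_verts G v r. out_arcs G x \<union> in_arcs G x)"
      using ball_verts_mono[of s r G v] by auto
  qed
  moreover have "finite \<dots>"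
    using V assms ball_verts_subset[OF assms(1,3), of r] by (auto simp: locally_finite_def)
  ultimately show "finite (arcs (rooted_ball G v r))" by (rule finite_subset)
qed

lemma rooted_graph_countable:
  assumes "rooted_graph G v"
  shows "countable (verts G)" "countable (arcs G)"
proof -
  have G: "wf_digraph G" "locally_finite G" "v \<in> verts G"
    using assms by (auto simp: rooted_graph_def)
  have "verts G \<subseteq> (\<Union>r. ball_verts G v r)"
    using assms connected_iff_ball[OF G(1,3)] by (auto simp: rooted_graph_def)
  moreover have "countable (\<Union>r. ball_verts G v r)"
    using finite_ball[OF G] by (auto intro: countable_finite)
  ultimately show V: "countable (verts G)" by (rule countable_subset)
  have "arcs G \<subseteq> (\<Union>x \<in> verts G. out_arcs G x)"
    using G by (auto simp: wf_digraph_def)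
  moreover have "countable (\<Union>x \<in> verts G. out_arcs G x)"
    using V G by (auto simp: locally_finite_def intro: countable_finite)
  ultimately show "countable (arcs G)" by (rule countable_subset)
qed

lemma rooted_iso_of_balls_iso:
  assumes G: "rooted_graph G v" and H: "rooted_graph H w" and iso: "\<And>r. balls_iso G v H w r"
  shows "rooted_iso G v H w"
proof -
  have G': "wf_digraph G" "locally_finite G" "v \<in> verts G"
    and H': "wf_digraph H" "locally_finite H" "w \<in> verts H"
    using G H by (auto simp: rooted_graph_def)
  obtain F where "\<forall>r. \<exists>g. iso_maps (F r) g (rooted_ball G v r) v (rooted_ball H w r) w"
    using iso unfolding balls_iso_iff by metis
  then obtain E where FE: "\<And>r. iso_maps (F r) (E r) (rooted_ball G v r) v (rooted_ball H w r) w"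
    by metis
  have FE': "iso_maps (F r) (E r) (rooted_ball G v s) v (rooted_ball H w s) w" if "s \<le> r" for r s
    using FE that by (rule iso_maps_ball_antimono)
  define R where
    "R s r = (restrict (F r) (ball_verts G v s), restrict (E r) (arcs (rooted_ball G v s)))" for s r
  have fin: "finite (R s ` {s..})" for s
  proof (rule finite_subset)
    show "R s ` {s..} \<subseteq>
        (ball_verts G v s \<rightarrow>\<^sub>E ball_verts H w s) \<times>
        (arcs (rooted_ball G v s) \<rightarrow>\<^sub>E arcs (rooted_ball H w s))"
    proof
      fix c assume "c \<in> R s ` {s..}"
      then obtain q where q: "s \<le> q" "c = R s q" by auto
      have "F q ` ball_verts G v s = ball_verts H w s"
        "E q ` arcs (rooted_ball G v s) = arcs (rooted_ball H w s)"
        using FE'[OF q(1)] by (simp_all add: iso_maps_def bij_betw_def)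
      then show "c \<in> (ball_verts G v s \<rightarrow>\<^sub>E ball_verts H w s) \<times>
          (arcs (rooted_ball G v s) \<rightarrow>\<^sub>E arcs (rooted_ball H w s))"
        unfolding q(2) R_def by (intro SigmaI restrict_PiE_iff[THEN iffD2] ballI) blast+
    qed
    show "finite \<dots>"
      using finite_ball[OF G'] finite_ball[OF H'] by (intro finite_cartesian_product finite_PiE) auto
  qed
  have pigeon: "\<exists>B \<subseteq> A. infinite B \<and> B \<subseteq> {s..} \<and> (\<exists>c. \<forall>r \<in> B. R s r = c)"
    if A: "infinite A" for A :: "nat set" and s
  proof -
    have inf: "infinite (A \<inter> {s..})"
    proof
      assume "finite (A \<inter> {s..})"
      moreover have "A \<subseteq> (A \<inter> {s..}) \<union> {..<s}" by auto
      ultimately show False using A by (meson finite_UnI finite_lessThan finite_subset)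
    qed
    have "finite (R s ` (A \<inter> {s..}))" by (rule finite_subset[OF _ fin[of s]]) auto
    from pigeonhole_infinite[OF inf this] obtain a where
      "infinite {r \<in> A \<inter> {s..}. R s r = R s a}" by auto
    then show ?thesis by (intro exI[of _ "{r \<in> A \<inter> {s..}. R s r = R s a}"]) auto
  qed
  have "\<exists>A :: nat \<Rightarrow> nat set. \<forall>s. (infinite (A s) \<and> A s \<subseteq> {s..} \<and> (\<exists>c. \<forall>r \<in> A s. R s r = c)) \<and>
      A (Suc s) \<subseteq> A s"
  proof (rule dependent_nat_choice)
    show "\<exists>B. infinite B \<and> B \<subseteq> {0::nat..} \<and> (\<exists>c. \<forall>r \<in> B. R 0 r = c)"
      using pigeon[of UNIV 0] by auto
    show "\<exists>B. (infinite B \<and> B \<subseteq> {Suc s..} \<and> (\<exists>c. \<forall>r \<in> B. R (Suc s) r = c)) \<and> B \<subseteq> A"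
      if "infinite A \<and> A \<subseteq> {s..} \<and> (\<exists>c. \<forall>r \<in> A. R s r = c)" for A :: "nat set" and s
      using pigeon[of A "Suc s"] that by blast
  qed
  then obtain A :: "nat \<Rightarrow> nat set" where A: "\<And>s. infinite (A s)" "\<And>s. A s \<subseteq> {s..}"
    "\<And>s. \<exists>c. \<forall>r \<in> A s. R s r = c" "\<And>s. A (Suc s) \<subseteq> A s" by (elim exE) blast
  have Amono: "A t \<subseteq> A s" if "s \<le> t" for s t
    using that A(4) by (rule lift_Suc_antimono_le[rotated]) 
  have "\<forall>s. \<exists>r. r \<in> A s" using A(1) by (metis finite.emptyI ex_in_conv)
  then obtain \<rho> where \<rho>: "\<And>s. \<rho> s \<in> A s" by metis
  have \<rho>_ge: "s \<le> \<rho> s" for s using \<rho> A(2) by fastforce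
  have R\<rho>: "R s (\<rho> t) = R s (\<rho> s)" if "s \<le> t" for s t
    using A(3)[of s] \<rho>[of s] \<rho>[of t] Amono[OF that] by auto
  have coh: "F (\<rho> t) x = F (\<rho> s) x" if "s \<le> t" "x \<in> ball_verts G v s" for s t x
    using R\<rho>[OF that(1)] that(2) unfolding R_def by (metis prod.inject restrict_apply')
  have coh': "E (\<rho> t) e = E (\<rho> s) e" if "s \<le> t" "e \<in> arcs (rooted_ball G v s)" for s t e
    using R\<rho>[OF that(1)] that(2) unfolding R_def by (metis prod.inject restrict_apply')
  define f where "f x = F (\<rho> (LEAST s. x \<in> ball_verts G v s)) x" for x
  define g where "g e = E (\<rho> (LEAST s. e \<in> arcs (rooted_ball G v s))) e" for e
  have f: "f x = F (\<rho> s) x" if "x \<in> ball_verts G v s" for x s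
    unfolding f_def using that by (intro coh[symmetric] Least_le) (auto intro: LeastI)
  have g: "g e = E (\<rho> s) e" if "e \<in> arcs (rooted_ball G v s)" for e s
    unfolding g_def using that by (intro coh'[symmetric] Least_le) (auto intro: LeastI)
  have ball: "iso_maps f g (rooted_ball G v s) v (rooted_ball H w s) w" for s
  proof -
    have "iso_maps (F (\<rho> s)) (E (\<rho> s)) (rooted_ball G v s) v (rooted_ball H w s) w"
      using FE' \<rho>_ge by blast
    moreover have "bij_betw f (ball_verts G v s) B \<longleftrightarrow> bij_betw (F (\<rho> s)) (ball_verts G v s) B" for B
      by (rule bij_betw_cong) (rule f)
    moreover have "bij_betw g (arcs (rooted_ball G v s)) B \<longleftrightarrow>
        bij_betw (E (\<rho> s)) (arcs (rooted_ball G v s)) B" for B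
      by (rule bij_betw_cong) (rule g)
    moreover have "f (tail G e) = F (\<rho> s) (tail G e)" "f (head G e) = F (\<rho> s) (head G e)"
      if "e \<in> arcs (rooted_ball G v s)" for e
      using that wf_rooted_ball[of G v s] by (auto simp: wf_digraph_def intro!: f)
    moreover have "f v = F (\<rho> s) v" by (rule f) simp
    ultimately show ?thesis using g by (auto simp: iso_maps_def)
  qed
  have exG: "\<exists>s. x \<in> ball_verts G v s" if "x \<in> verts G" for x
    using G that connected_iff_ball[OF G'(1,3)] by (auto simp: rooted_graph_def)
  have exH: "\<exists>s. x \<in> ball_verts H w s" if "x \<in> verts H" for x
    using H that connected_iff_ball[OF H'(1,3)] by (auto simp: rooted_graph_def)
  have arcs_mono: "arcs (rooted_ball K u s) \<subseteq> arcs (rooted_ball K u t)" if "s \<le> t"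
    for s t and K :: "('x, 'y) pre_digraph" and u
    using that by (auto simp: arcs_rooted_ball intro: less_le_trans)
  have exGa: "\<exists>s. e \<in> arcs (rooted_ball G v s)" if "e \<in> arcs G" for e
    using exG[of "tail G e"] that G'(1) by (auto simp: arcs_rooted_ball wf_digraph_def)
  have exHa: "\<exists>s. e \<in> arcs (rooted_ball H w s)" if "e \<in> arcs H" for e
    using exH[of "tail H e"] that H'(1) by (auto simp: arcs_rooted_ball wf_digraph_def)
  have "bij_betw f (verts G) (verts H)"
    unfolding bij_betw_def
  proof (intro conjI inj_onI Set.set_eqI iffI)
    fix x y assume xy: "x \<in> verts G" "y \<in> verts G" "f x = f y"
    then obtain s t where "x \<in> ball_verts G v s" "y \<in> ball_verts G v t" using exG by meson
    then have "x \<in> ball_verts G v (max s t)" "y \<in> ball_verts G v (max s t)"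
      using ball_verts_mono[of s "max s t" G v] ball_verts_mono[of t "max s t" G v] by auto
    then show "x = y" using ball[of "max s t"] xy(3) by (auto simp: iso_maps_def bij_betw_def inj_on_def)
  next
    fix y assume "y \<in> f ` verts G"
    then obtain x s where "x \<in> ball_verts G v s" "y = f x" using exG by blast
    then have "y \<in> ball_verts H w s" using ball[of s] by (auto simp: iso_maps_def bij_betw_def)
    then show "y \<in> verts H" using ball_verts_subset[OF H'(1,3)] by auto
  next
    fix y assume "y \<in> verts H"
    then obtain s where "y \<in> ball_verts H w s" using exH by blast
    then have "y \<in> f ` ball_verts G v s" using ball[of s] by (auto simp: iso_maps_def bij_betw_def)
    then show "y \<in> f ` verts G" using ball_verts_subset[OF G'(1,3)] by auto
  qed
  moreover have "bij_betw g (arcs G) (arcs H)"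
    unfolding bij_betw_def
  proof (intro conjI inj_onI Set.set_eqI iffI)
    fix x y assume xy: "x \<in> arcs G" "y \<in> arcs G" "g x = g y"
    then obtain s t where "x \<in> arcs (rooted_ball G v s)" "y \<in> arcs (rooted_ball G v t)"
      using exGa by meson
    then have "x \<in> arcs (rooted_ball G v (max s t))" "y \<in> arcs (rooted_ball G v (max s t))"
      using arcs_mono[of s "max s t" G v] arcs_mono[of t "max s t" G v] by auto
    then show "x = y" using ball[of "max s t"] xy(3) by (auto simp: iso_maps_def bij_betw_def inj_on_def)
  next
    fix y assume "y \<in> g ` arcs G"
    then obtain x s where "x \<in> arcs (rooted_ball G v s)" "y = g x" using exGa by blast
    then have "y \<in> arcs (rooted_ball H w s)" using ball[of s] by (auto simp: iso_maps_def bij_betw_def)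
    then show "y \<in> arcs H" by (auto simp: arcs_rooted_ball)
  next
    fix y assume "y \<in> arcs H"
    then obtain s where "y \<in> arcs (rooted_ball H w s)" using exHa by blast
    then have "y \<in> g ` arcs (rooted_ball G v s)" using ball[of s] by (auto simp: iso_maps_def bij_betw_def)
    then show "y \<in> g ` arcs G" by (auto simp: arcs_rooted_ball)
  qed
  moreover have "f (tail G e) = tail H (g e) \<and> f (head G e) = head H (g e)" if "e \<in> arcs G" for e
    using exGa[OF that] ball by (auto simp: iso_maps_def)
  moreover have "f v = w" using ball[of 0] by (auto simp: iso_maps_def)
  ultimately have "iso_maps f g G v H w" by (auto simp: iso_maps_def)
  then show ?thesis using G'(1) by (auto simp: rooted_iso_iff)
qed


section \<open>The space of rooted graphs\<close>

text \<open>
  A connected locally finite graph is countable, so every isomorphism class of connected locally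
  finite rooted graphs is represented by a graph whose vertices and arcs are natural numbers.
  Local finiteness is what makes the distance below separate points.
\<close>

definition rgraph_rel ::
    "(nat, nat) pre_digraph \<times> nat \<Rightarrow> (nat, nat) pre_digraph \<times> nat \<Rightarrow> bool" where
  "rgraph_rel = (\<lambda>(G, v) (H, w). rooted_graph G v \<and> rooted_graph H w \<and> rooted_iso G v H w)"

lemma rgraph_rel_part_equivp: "part_equivp rgraph_rel"
proof (rule part_equivpI)
  let ?G = "\<lparr>verts = {0}, arcs = {}, tail = id, head = id\<rparr> :: (nat, nat) pre_digraph"
  have wf: "wf_digraph ?G" by unfold_locales auto
  then have "rooted_graph ?G 0"
    by (auto simp: rooted_graph_def locally_finite_def connected_iff_ball[OF wf, of 0]
        out_arcs_def in_arcs_def)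
  then show "\<exists>x. rgraph_rel x x"
    by (intro exI[of _ "(?G, 0)"]) (auto simp: rgraph_rel_def rooted_iso_refl wf)
  show "symp rgraph_rel"
    by (auto simp: rgraph_rel_def symp_def rooted_graph_def intro: rooted_iso_sym)
  show "transp rgraph_rel"
    by (auto simp: rgraph_rel_def transp_def intro: rooted_iso_trans)
qed

quotient_type rgraph = "(nat, nat) pre_digraph \<times> nat" / partial: rgraph_rel
  by (rule rgraph_rel_part_equivp)

text \<open>
  The distance is \<open>1 / (1 + r)\<close> for the largest \<open>r\<close> such that the balls of radius \<open>r\<close> are
  isomorphic, and \<open>0\<close> if there is no largest one, that is, if balls of every radius are isomorphic.
\<close>

definition root_dist :: "('v, 'e) pre_digraph \<times> 'v \<Rightarrow> ('w, 'f) pre_digraph \<times> 'w \<Rightarrow> real" where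
  "root_dist = (\<lambda>(G, v) (H, w).
     if \<forall>r. balls_iso G v H w r then 0
     else 1 / (1 + real (GREATEST r. balls_iso G v H w r)))"

lemma root_dist_le_iff:
  "root_dist (G, v) (H, w) \<le> 1 / (1 + real r) \<longleftrightarrow> balls_iso G v H w r"
proof (cases "\<forall>r. balls_iso G v H w r")
  case True
  then show ?thesis by (simp add: root_dist_def)
next
  case False
  then obtain b where b: "\<not> balls_iso G v H w b" by blast
  have bound: "s \<le> b" if "balls_iso G v H w s" for s
    using that b balls_iso_antimono by (metis nle_le)
  let ?m = "GREATEST r. balls_iso G v H w r"
  have m: "balls_iso G v H w ?m"
    using balls_iso_0 bound by (rule GreatestI_nat)
  have "r \<le> ?m \<longleftrightarrow> balls_iso G v H w r"
  proof
    show "balls_iso G v H w r" if "r \<le> ?m" using m that by (rule balls_iso_antimono)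
    show "r \<le> ?m" if "balls_iso G v H w r" using that bound by (rule Greatest_le_nat)
  qed
  moreover have "1 / (1 + real a) \<le> 1 / (1 + real b) \<longleftrightarrow> b \<le> a" for a b :: nat
    by (simp add: field_simps)
  moreover have "root_dist (G, v) (H, w) = 1 / (1 + real ?m)"
    unfolding root_dist_def prod.case using False by (rule if_not_P)
  ultimately show ?thesis by metis
qed

lemma root_dist_cases:
  "root_dist p q = 0 \<or> (\<exists>r. root_dist p q = 1 / (1 + real r))"
  by (auto simp: root_dist_def split: prod.splits)

lemma root_dist_eqI:
  assumes "\<And>r. balls_iso G v H w r \<longleftrightarrow> balls_iso G' v' H' w' r"
  shows "root_dist (G, v) (H, w) = root_dist (G', v') (H', w')"
proof -
  have "balls_iso G v H w = balls_iso G' v' H' w'" using assms by blast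
  then show ?thesis by (simp add: root_dist_def)
qed

instantiation rgraph :: metric_space
begin

lift_definition dist_rgraph :: "rgraph \<Rightarrow> rgraph \<Rightarrow> real" is root_dist
proof -
  fix p p' q q' assume *: "rgraph_rel p p'" "rgraph_rel q q'"
  obtain G v G' v' H w H' w' where [simp]: "p = (G, v)" "p' = (G', v')" "q = (H, w)" "q' = (H', w')"
    by (cases p, cases p', cases q, cases q')
  have "balls_iso G v G' v' r" "balls_iso H w H' w' r" for r
    using * by (auto simp: rgraph_rel_def rooted_graph_def intro: rooted_iso_imp_balls_iso)
  then show "root_dist p q = root_dist p' q'"
    by (auto intro!: root_dist_eqI) (meson balls_iso_trans balls_iso_sym)+
qed

definition uniformity_rgraph :: "(rgraph \<times> rgraph) filter" where
  "uniformity_rgraph = (INF e\<in>{0<..}. principal {(x, y). dist x y < e})"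

definition open_rgraph :: "rgraph set \<Rightarrow> bool" where
  "open_rgraph U \<longleftrightarrow> (\<forall>x\<in>U. \<forall>\<^sub>F (x', y) in uniformity. x' = x \<longrightarrow> y \<in> U)"

instance
proof
  show "uniformity = (INF e\<in>{0<..}. principal {(x, y). dist x y < (e::real)} :: (rgraph \<times> rgraph) filter)"
    by (rule uniformity_rgraph_def)
  show "open U \<longleftrightarrow> (\<forall>x\<in>U. \<forall>\<^sub>F (x', y) in uniformity. x' = x \<longrightarrow> y \<in> U)" for U :: "rgraph set"
    by (rule open_rgraph_def)
  show "dist x y = 0 \<longleftrightarrow> x = y" for x y :: rgraph
  proof transfer
    fix p q assume "rgraph_rel p p" "rgraph_rel q q"
    then obtain G v H w where [simp]: "p = (G, v)" "q = (H, w)" and G: "rooted_graph G v" "rooted_graph H w"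
      by (cases p, cases q) (auto simp: rgraph_rel_def)
    have "root_dist p q = 0 \<longleftrightarrow> (\<forall>r. balls_iso G v H w r)"
      by (auto simp: root_dist_def)
    also have "\<dots> \<longleftrightarrow> rooted_iso G v H w"
    proof
      show "rooted_iso G v H w" if "\<forall>r. balls_iso G v H w r"
        using G that by (intro rooted_iso_of_balls_iso) auto
      have "v \<in> verts G" using G by (simp add: rooted_graph_def)
      then show "\<forall>r. balls_iso G v H w r" if "rooted_iso G v H w"
        using that by (intro allI rooted_iso_imp_balls_iso)
    qed
    finally show "root_dist p q = 0 \<longleftrightarrow> rgraph_rel p q"
      using G by (simp add: rgraph_rel_def)
  qed
  show "dist x y \<le> dist x z + dist y z" for x y z :: rgraph
  proof transfer
    fix p q s :: "(nat, nat) pre_digraph \<times> nat"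
    obtain G v H w K u where [simp]: "p = (G, v)" "q = (H, w)" "s = (K, u)"
      by (cases p, cases q, cases s)
    have nonneg: "0 \<le> root_dist a b" for a b :: "(nat, nat) pre_digraph \<times> nat"
      by (auto simp: root_dist_def split: prod.splits)
    have "root_dist p q \<le> max (root_dist p s) (root_dist q s)"
    proof (cases "max (root_dist p s) (root_dist q s) = 0")
      case True
      then have "root_dist p s = 0" "root_dist q s = 0"
        using nonneg[of p s] nonneg[of q s] by (auto simp: max_def split: if_splits)
      then have "\<forall>r. balls_iso G v K u r" "\<forall>r. balls_iso H w K u r"
        by (auto simp: root_dist_def split: if_splits)
      then have "\<forall>r. balls_iso G v H w r" by (meson balls_iso_trans balls_iso_sym)
      then show ?thesis using nonneg[of p s] by (simp add: root_dist_def max_def)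
    next
      case False
      then obtain r where r: "max (root_dist p s) (root_dist q s) = 1 / (1 + real r)"
        using root_dist_cases[of p s] root_dist_cases[of q s] by (auto simp: max_def split: if_splits)
      then have "root_dist p s \<le> 1 / (1 + real r)" "root_dist q s \<le> 1 / (1 + real r)"
        by (auto simp flip: r)
      then have "balls_iso G v K u r" "balls_iso H w K u r" by (simp_all add: root_dist_le_iff)
      then have "balls_iso G v H w r" by (meson balls_iso_trans balls_iso_sym)
      then show ?thesis unfolding r by (simp add: root_dist_le_iff)
    qed
    then show "root_dist p q \<le> root_dist p s + root_dist q s"
      using nonneg[of p s] nonneg[of q s] by linarith
  qed
qed

end

definition rooted_class :: "('v, 'e) pre_digraph \<Rightarrow> 'v \<Rightarrow> rgraph" where
  "rooted_class G v =
     (THE x. \<exists>H w. rooted_graph H w \<and> rooted_iso (component G v) v H w \<and> x = abs_rgraph (H, w))"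

lemma rooted_graph_component:
  assumes "wf_digraph G" "locally_finite G" "v \<in> verts G"
  shows "rooted_graph (component G v) v"
proof -
  let ?C = "component G v"
  have V: "verts ?C = {w. \<exists>r. w \<in> ball_verts G v r}"
    using assms by (simp add: component_def reachable_iff_ball)
  have A: "arcs ?C = {e \<in> arcs G. tail G e \<in> verts ?C \<and> head G e \<in> verts ?C}"
    and th: "tail ?C = tail G" "head ?C = head G"
    by (auto simp: component_def induce_subgraph_def)
  have wf: "wf_digraph ?C" by unfold_locales (auto simp: A th)
  have "locally_finite ?C"
    unfolding locally_finite_def
  proof
    fix x assume "x \<in> verts ?C"
    then have "x \<in> verts G" using V ball_verts_subset[OF assms(1,3)] by auto
    moreover have "out_arcs ?C x \<subseteq> out_arcs G x" "in_arcs ?C x \<subseteq> in_arcs G x"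
      by (auto simp: out_arcs_def in_arcs_def A th)
    ultimately show "finite (out_arcs ?C x) \<and> finite (in_arcs ?C x)"
      using assms(2) finite_subset unfolding locally_finite_def by blast
  qed
  moreover have v: "v \<in> verts ?C" by (auto simp: V)
  moreover have "ball_verts G v r \<subseteq> ball_verts ?C v r" for r
  proof (induction r)
    case (Suc r)
    have "(x, y) \<in> parcs (mk_symmetric ?C)"
      if "x \<in> ball_verts G v r" "(x, y) \<in> parcs (mk_symmetric G)" for x y
    proof -
      have "y \<in> ball_verts G v (Suc r)" using that by (auto simp: ball_verts_Suc)
      then have "x \<in> verts ?C" "y \<in> verts ?C" using that V by blast+
      then show ?thesis using that(2) by (auto simp: adj_iff A th)
    qed
    then show ?case using Suc by (auto simp: ball_verts_Suc)
  qed simp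
  then have "Digraph_Component.connected ?C"
    unfolding connected_iff_ball[OF wf v] by (auto simp: V)
  ultimately show ?thesis using wf by (simp add: rooted_graph_def)
qed

lemma rooted_graph_nat_copy:
  assumes "rooted_graph G v"
  obtains H :: "(nat, nat) pre_digraph" and w where "rooted_graph H w" "rooted_iso G v H w"
proof -
  have wf: "wf_digraph G" using assms by (simp add: rooted_graph_def)
  let ?f = "to_nat_on (verts G)" and ?g = "to_nat_on (arcs G)"
  let ?H = "\<lparr>verts = ?f ` verts G, arcs = ?g ` arcs G,
      tail = (\<lambda>e. ?f (tail G (the_inv_into (arcs G) ?g e))),
      head = (\<lambda>e. ?f (head G (the_inv_into (arcs G) ?g e)))\<rparr>"
  have inj: "inj_on ?f (verts G)" "inj_on ?g (arcs G)"
    using rooted_graph_countable[OF assms] by auto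
  then have "iso_maps ?f ?g G v ?H (?f v)"
    by (auto simp: iso_maps_def bij_betw_def the_inv_into_f_f)
  then have "rooted_iso G v ?H (?f v)" using wf by (auto simp: rooted_iso_iff)
  from that[OF rooted_iso_rooted_graph[OF this assms] this] show thesis .
qed

text \<open>The following facts show that \<^const>\<open>rooted_class\<close> is well defined on locally finite graphs.\<close>

lemma rooted_classE:
  assumes "wf_digraph G" "locally_finite G" "v \<in> verts G"
  obtains H w where "rooted_graph H w" "rooted_iso (component G v) v H w"
    "rooted_class G v = abs_rgraph (H, w)"
proof -
  have C: "rooted_graph (component G v) v" by (rule rooted_graph_component[OF assms])
  then obtain H :: "(nat, nat) pre_digraph" and w where
    H: "rooted_graph H w" "rooted_iso (component G v) v H w"
    by (rule rooted_graph_nat_copy)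
  have uniq: "abs_rgraph (H', w') = abs_rgraph (H, w)"
    if "rooted_graph H' w'" "rooted_iso (component G v) v H' w'" for H' w'
  proof -
    have "rooted_iso H' w' H w"
      using rooted_iso_trans[OF rooted_iso_sym[OF that(2)] H(2)] C by (simp add: rooted_graph_def)
    then have "rgraph_rel (H', w') (H, w)" using that H by (simp add: rgraph_rel_def)
    then show ?thesis by (rule Quotient3_rel_abs[OF Quotient3_rgraph])
  qed
  have "rooted_class G v = abs_rgraph (H, w)"
    unfolding rooted_class_def using H uniq by (intro the_equality) blast+
  then show thesis using that H by blast
qed

lemma rooted_class_eq_iff:
  assumes G: "wf_digraph G" "locally_finite G" "v \<in> verts G"
    and H: "wf_digraph H" "locally_finite H" "w \<in> verts H"
  shows "rooted_class G v = rooted_class H w \<longleftrightarrow> rooted_iso (component G v) v (component H w) w"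
proof -
  obtain G' v' where G': "rooted_graph G' v'" "rooted_iso (component G v) v G' v'"
    "rooted_class G v = abs_rgraph (G', v')" using rooted_classE[OF G] .
  obtain H' w' where H': "rooted_graph H' w'" "rooted_iso (component H w) w H' w'"
    "rooted_class H w = abs_rgraph (H', w')" using rooted_classE[OF H] .
  have v: "v \<in> verts (component G v)" "w \<in> verts (component H w)"
    using rooted_graph_component[OF G] rooted_graph_component[OF H] by (auto simp: rooted_graph_def)
  have v': "v' \<in> verts G'" "w' \<in> verts H'" "wf_digraph G'" "wf_digraph H'"
    using G' H' by (auto simp: rooted_graph_def)
  have "abs_rgraph (G', v') = abs_rgraph (H', w') \<longleftrightarrow> rgraph_rel (G', v') (H', w')"
    using G'(1) H'(1) v' Quotient3_rel[OF Quotient3_rgraph, of "(G', v')" "(H', w')"]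
    by (auto simp: rgraph_rel_def rooted_iso_refl)
  also have "\<dots> \<longleftrightarrow> rooted_iso G' v' H' w'" using G' H' by (simp add: rgraph_rel_def)
  also have "\<dots> \<longleftrightarrow> rooted_iso (component G v) v (component H w) w"
    using G'(2) H'(2) v v' by (meson rooted_iso_sym rooted_iso_trans)
  finally show ?thesis using G' H' by simp
qed


section \<open>Benjamini--Schramm convergence\<close>

definition transitive_graph :: "('v, 'e) pre_digraph \<Rightarrow> bool" where
  "transitive_graph G \<longleftrightarrow>
     wf_digraph G \<and> locally_finite G \<and> Digraph_Component.connected G \<and>
     (\<forall>v \<in> verts G. \<forall>w \<in> verts G. rooted_iso G v G w)"

text \<open>
  For an infinite graph the law is only meaningful if the graph is transitive, in which case the
  choice of the root does not matter; \<open>has_root_law\<close> records this side condition.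
\<close>

definition root_law :: "('v, 'e) pre_digraph \<Rightarrow> rgraph measure" where
  "root_law G =
     (if finite (verts G) then distr (uniform_count_measure (verts G)) borel (rooted_class G)
      else return borel (rooted_class G (SOME v. v \<in> verts G)))"

definition has_root_law :: "('v, 'e) pre_digraph \<Rightarrow> bool" where
  "has_root_law G \<longleftrightarrow> (fin_digraph G \<and> verts G \<noteq> {}) \<or> transitive_graph G"

definition weakly_converges ::
    "('i \<Rightarrow> 'a::topological_space measure) \<Rightarrow> 'a measure \<Rightarrow> 'i filter \<Rightarrow> bool" where
  "weakly_converges \<mu> \<nu> F \<longleftrightarrow>
     (\<forall>f :: 'a \<Rightarrow> real. continuous_on UNIV f \<longrightarrow> bounded (range f) \<longrightarrow>
        ((\<lambda>i. \<integral>x. f x \<partial>\<mu> i) \<longlongrightarrow> (\<integral>x. f x \<partial>\<nu>)) F)"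

definition bs_converges ::
    "('i \<Rightarrow> ('v, 'e) pre_digraph) \<Rightarrow> ('w, 'f) pre_digraph \<Rightarrow> 'i filter \<Rightarrow> bool" where
  "bs_converges \<Gamma> G F \<longleftrightarrow>
     transitive_graph G \<and> (\<forall>\<^sub>F i in F. has_root_law (\<Gamma> i)) \<and>
     (\<forall>v \<in> verts G. weakly_converges (\<lambda>i. root_law (\<Gamma> i)) (return borel (rooted_class G v)) F)"


section \<open>Spider-web graphs, de Bruijn graphs, and the lamplighter group\<close>

definition level_group :: "enat \<Rightarrow> int monoid" where
  "level_group M = (case M of enat m \<Rightarrow> integer_mod_group m | \<infinity> \<Rightarrow> integer_group)"

text \<open>
  The arc labelled \<open>R\<^sub>y\<close> leaving a vertex is the pair of that vertex and \<open>y\<close>. Words are lists; for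
  words of length \<open>0\<close> the expression \<open>tl (x @ [y])\<close> is again the empty word. Only \<open>M \<ge> 1\<close> is
  intended (\<^term>\<open>integer_mod_group 0\<close> is the infinite cyclic group).
\<close>

definition spider_web ::
    "nat \<Rightarrow> nat \<Rightarrow> enat \<Rightarrow> (nat list \<times> int, (nat list \<times> int) \<times> nat) pre_digraph" where
  "spider_web k N M =
     (let V = {x. length x = N \<and> set x \<subseteq> {..<k}} \<times> carrier (level_group M) in
      \<lparr>verts = V,
       arcs = V \<times> {..<k},
       tail = fst,
       head = (\<lambda>((x, i), y). (tl (x @ [y]), i \<otimes>\<^bsub>level_group M\<^esub> 1))\<rparr>)"

definition de_bruijn :: "nat \<Rightarrow> nat \<Rightarrow> (nat list \<times> int, (nat list \<times> int) \<times> nat) pre_digraph" where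
  "de_bruijn k N = spider_web k N 1"

text \<open>
  The lamplighter group as the semidirect product of the direct sum of copies of
  \<open>\<int>/k\<int>\<close> with \<open>\<int>\<close>: the integer \<open>m\<close> acts by translating configurations by \<open>m\<close>.
\<close>

definition lamp_configs :: "nat \<Rightarrow> (int \<Rightarrow> int) monoid" where
  "lamp_configs k = sum_group UNIV (\<lambda>_. integer_mod_group k)"

definition lamplighter :: "nat \<Rightarrow> ((int \<Rightarrow> int) \<times> int) monoid" where
  "lamplighter k =
     \<lparr>carrier = carrier (lamp_configs k) \<times> UNIV,
      monoid.mult = (\<lambda>(f, m) (g, n). (f \<otimes>\<^bsub>lamp_configs k\<^esub> (\<lambda>i. g (i - m)), m + n)),
      one = (\<one>\<^bsub>lamp_configs k\<^esub>, 0)\<rparr>"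

definition lamp_b :: "nat \<Rightarrow> (int \<Rightarrow> int) \<times> int" where
  "lamp_b k = (\<one>\<^bsub>lamp_configs k\<^esub>, 1)"

definition lamp_c :: "(int \<Rightarrow> int) \<times> int" where
  "lamp_c = ((\<lambda>i. if i = 0 then 1 else 0), 0)"

definition lamp_gens :: "nat \<Rightarrow> ((int \<Rightarrow> int) \<times> int) set" where
  "lamp_gens k = (\<lambda>r. lamp_c [^]\<^bsub>lamplighter k\<^esub> r \<otimes>\<^bsub>lamplighter k\<^esub> lamp_b k) ` {..<k}"

definition cayley_graph :: "('a, 'b) monoid_scheme \<Rightarrow> 'a set \<Rightarrow> ('a, 'a \<times> 'a) pre_digraph" where
  "cayley_graph G X =
     \<lparr>verts = carrier G, arcs = carrier G \<times> X, tail = fst, head = (\<lambda>(g, x). g \<otimes>\<^bsub>G\<^esub> x)\<rparr>"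

lemma carrier_lamp_configs:
  "carrier (lamp_configs k) = {f. (\<forall>i. f i \<in> carrier (integer_mod_group k)) \<and> finite {i. f i \<noteq> 0}}"
  by (auto simp: lamp_configs_def carrier_sum_group)

lemma mult_lamp_configs: "f \<otimes>\<^bsub>lamp_configs k\<^esub> g = (\<lambda>i. (f i + g i) mod int k)"
  by (auto simp: lamp_configs_def)

lemma one_lamp_configs: "\<one>\<^bsub>lamp_configs k\<^esub> = (\<lambda>_. 0)"
  by (auto simp: lamp_configs_def)

lemma group_lamp_configs: "group (lamp_configs k)"
  unfolding lamp_configs_def by simp

lemma shift_lamp_configs:
  assumes "f \<in> carrier (lamp_configs k)"
  shows "(\<lambda>i. f (i - m)) \<in> carrier (lamp_configs k)"
proof -
  have "{i. f (i - m) \<noteq> 0} = (\<lambda>i. i + m) ` {i. f i \<noteq> 0}"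
    by (force simp: image_iff intro: exI[of _ "_ - m"])
  then show ?thesis using assms by (auto simp: carrier_lamp_configs)
qed

lemma group_lamplighter: "group (lamplighter k)"
proof (rule groupI)
  interpret C: group "lamp_configs k" by (rule group_lamp_configs)
  fix x y z assume "x \<in> carrier (lamplighter k)" "y \<in> carrier (lamplighter k)" "z \<in> carrier (lamplighter k)"
  then show "x \<otimes>\<^bsub>lamplighter k\<^esub> y \<in> carrier (lamplighter k)"
    "\<one>\<^bsub>lamplighter k\<^esub> \<otimes>\<^bsub>lamplighter k\<^esub> x = x"
    using C.l_one shift_lamp_configs by (auto simp: lamplighter_def)
  show "x \<otimes>\<^bsub>lamplighter k\<^esub> y \<otimes>\<^bsub>lamplighter k\<^esub> z = x \<otimes>\<^bsub>lamplighter k\<^esub> (y \<otimes>\<^bsub>lamplighter k\<^esub> z)"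
    by (auto simp: lamplighter_def mult_lamp_configs mod_simps algebra_simps split: prod.splits)
next
  show "\<one>\<^bsub>lamplighter k\<^esub> \<in> carrier (lamplighter k)"
    using group.is_monoid[OF group_lamp_configs] by (auto simp: lamplighter_def monoid.one_closed)
next
  interpret C: group "lamp_configs k" by (rule group_lamp_configs)
  fix x assume x: "x \<in> carrier (lamplighter k)"
  obtain f m where fm: "x = (f, m)" "f \<in> carrier (lamp_configs k)"
    using x by (auto simp: lamplighter_def)
  let ?s = "\<lambda>i. f (i - (- m))"
  have s: "?s \<in> carrier (lamp_configs k)" using fm shift_lamp_configs by blast
  let ?y = "(inv\<^bsub>lamp_configs k\<^esub> ?s, - m)"
  have "?y \<in> carrier (lamplighter k)" using s by (auto simp: lamplighter_def)
  moreover have "?y \<otimes>\<^bsub>lamplighter k\<^esub> x = \<one>\<^bsub>lamplighter k\<^esub>"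
    using C.l_inv[OF s] by (simp add: lamplighter_def fm)
  ultimately show "\<exists>y \<in> carrier (lamplighter k). y \<otimes>\<^bsub>lamplighter k\<^esub> x = \<one>\<^bsub>lamplighter k\<^esub>" by blast
qed

end

theory Submission
  imports Defs
begin

text \<open>
  A homomorphism of oriented graphs that lifts the arcs at every vertex (a fibration) maps balls
  onto balls, so it identifies two balls as soon as it is injective on the vertices of the first one.

  The lamplighter Cayley graph fibres over every spider-web graph. Moving from \<open>(f, m)\<close> to level
  \<open>m + 1\<close> rewrites the lamp at \<open>m\<close>; let \<open>(f, m)\<close> correspond to the word whose letters are
  \<open>f j + f (j - N)\<close> mod \<open>k\<close> for \<open>m \<le> j < m + N\<close>. Then rewriting the lamp at \<open>m\<close> deletes the first
  letter and appends an arbitrary last letter. For \<open>N \<ge> 2 * r\<close> this map can fail to be injective on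
  an \<open>r\<close>-ball only if the levels wrap around modulo \<open>M\<close>, and then the middle part of the word at
  the root has a period at most \<open>2 * r\<close>. At most \<open>2 * r * k ^ (4 * r)\<close> of the \<open>k ^ N\<close> words do,
  independently of \<open>M\<close>, whence all limits with \<open>N \<rightarrow> \<infinity>\<close>. For fixed \<open>N\<close>, reducing levels modulo
  \<open>M\<close> is a fibration from the infinite spider-web graph that is injective on \<open>r\<close>-balls once
  \<open>M > 2 * r\<close>.
\<close>


section \<open>Fibrations and balls\<close>

text \<open>Lifts are required to exist at both ends of an arc but not to be unique. The injectivity
  that makes two balls isomorphic is a separate hypothesis of
  \<open>fibration_balls_iso\<close>.\<close>

definition fibration ::
    "('v \<Rightarrow> 'w) \<Rightarrow> ('e \<Rightarrow> 'f) \<Rightarrow> ('v, 'e) pre_digraph \<Rightarrow> ('w, 'f) pre_digraph \<Rightarrow> bool" where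
  "fibration f g G H \<longleftrightarrow>
     (\<forall>e \<in> arcs G. g e \<in> arcs H \<and> tail H (g e) = f (tail G e) \<and> head H (g e) = f (head G e)) \<and>
     (\<forall>v \<in> verts G. \<forall>e' \<in> arcs H.
        (tail H e' = f v \<longrightarrow> (\<exists>e \<in> arcs G. g e = e' \<and> tail G e = v)) \<and>
        (head H e' = f v \<longrightarrow> (\<exists>e \<in> arcs G. g e = e' \<and> head G e = v)))"

text \<open>Walks map to walks. This half needs no lifting and is kept apart because
  \<open>connected_spider_web\<close> uses it for every \<open>N\<close>, while
  \<open>fibration_lamp_word\<close> assumes \<open>N \<ge> 1\<close>.\<close>

lemma hom_ball_verts:
  assumes hom: "\<And>e. e \<in> arcs G \<Longrightarrow>
      g e \<in> arcs H \<and> tail H (g e) = f (tail G e) \<and> head H (g e) = f (head G e)"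
    and "x \<in> ball_verts G v r"
  shows "f x \<in> ball_verts H (f v) r"
  using assms(2)
proof (induction r arbitrary: x)
  case (Suc r)
  then consider "x \<in> ball_verts G v r"
    | y where "y \<in> ball_verts G v r" "(y, x) \<in> parcs (mk_symmetric G)"
    by (auto simp: ball_verts_Suc)
  then show ?case
  proof cases
    case 2
    then have "(f y, f x) \<in> parcs (mk_symmetric H)" using hom unfolding adj_iff by metis
    then show ?thesis using Suc.IH[OF 2(1)] by (auto simp: ball_verts_Suc)
  qed (use Suc.IH in \<open>auto simp: ball_verts_Suc\<close>)
qed simp

text \<open>A walk in \<open>H\<close> that starts at \<open>f v\<close> lifts arc by arc to a walk
  in \<open>G\<close> that starts at \<open>v\<close>, whichever way each arc is traversed.\<close>

lemma fibration_ball_verts: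
  assumes fib: "fibration f g G H" and wf: "wf_digraph G" and v: "v \<in> verts G"
  shows "f ` ball_verts G v r = ball_verts H (f v) r"
proof
  show "f ` ball_verts G v r \<subseteq> ball_verts H (f v) r"
    using fib by (auto simp: fibration_def intro: hom_ball_verts)
  show "ball_verts H (f v) r \<subseteq> f ` ball_verts G v r"
  proof (induction r)
    case (Suc r)
    have "y \<in> f ` ball_verts G v (Suc r)"
      if x: "x \<in> ball_verts G v r" and y: "(f x, y) \<in> parcs (mk_symmetric H)" for x y
    proof -
      have xG: "x \<in> verts G" using x ball_verts_subset[OF wf v] by blast
      obtain e' where e': "e' \<in> arcs H"
        "tail H e' = f x \<and> head H e' = y \<or> tail H e' = y \<and> head H e' = f x"
        using y by (auto simp: adj_iff)
      then obtain e where "e \<in> arcs G" "g e = e'"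
        "tail G e = x \<and> y = f (head G e) \<or> head G e = x \<and> y = f (tail G e)"
        using fib xG unfolding fibration_def by metis
      then show ?thesis using ball_verts_step[of e G v r] x by auto
    qed
    moreover have "ball_verts H (f v) r \<subseteq> f ` ball_verts G v (Suc r)"
      using Suc ball_verts_mono[of r "Suc r" G v] by auto
    ultimately show ?case using Suc by (auto 0 3 simp: ball_verts_Suc[of H])
  qed simp
qed

text \<open>Arcs with the same image have tails with the same image. Injectivity on the vertices of
  the ball makes the tails equal, so it is enough that \<open>g\<close> separates arcs with a common
  tail.\<close>

lemma fibration_balls_iso:
  assumes fib: "fibration f g G H" and wf: "wf_digraph G" and v: "v \<in> verts G"
    and f: "inj_on f (ball_verts G v r)"
    and g: "\<And>e e'. \<lbrakk>e \<in> arcs G; e' \<in> arcs G; tail G e = tail G e'; g e = g e'\<rbrakk> \<Longrightarrow> e = e'"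
  shows "balls_iso G v H (f v) r"
proof -
  note ball = fibration_ball_verts[OF fib wf v]
  have hom: "g e \<in> arcs H \<and> tail H (g e) = f (tail G e) \<and> head H (g e) = f (head G e)"
    if "e \<in> arcs G" for e
    using fib that by (auto simp: fibration_def)
  have sub: "arcs (rooted_ball G v r) \<subseteq> arcs G" by (auto simp: arcs_rooted_ball)
  have "inj_on g (arcs (rooted_ball G v r))"
  proof (rule inj_onI)
    fix e e' assume e: "e \<in> arcs (rooted_ball G v r)" "e' \<in> arcs (rooted_ball G v r)" "g e = g e'"
    then have "f (tail G e) = f (tail G e')" using hom sub by (metis subsetD)
    moreover have "tail G e \<in> ball_verts G v r" "tail G e' \<in> ball_verts G v r"
      using e wf_rooted_ball[of G v r] by (auto simp: wf_digraph_def)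
    ultimately show "e = e'" using g e f sub by (meson inj_onD subsetD)
  qed
  moreover have "g ` arcs (rooted_ball G v r) = arcs (rooted_ball H (f v) r)"
  proof
    show "g ` arcs (rooted_ball G v r) \<subseteq> arcs (rooted_ball H (f v) r)"
      using hom by (auto simp: arcs_rooted_ball simp flip: ball)
    \<comment> \<open>Such an arc has an end at distance \<open>s < r\<close> from
      \<open>f v\<close>; that end is the image of some \<open>x\<close> at distance at most
      \<open>s\<close> from \<open>v\<close>, and the arc lifts to an arc at
      \<open>x\<close>.\<close>
    show "arcs (rooted_ball H (f v) r) \<subseteq> g ` arcs (rooted_ball G v r)"
    proof
      fix e' assume "e' \<in> arcs (rooted_ball H (f v) r)"
      then obtain s x where s: "s < r" "e' \<in> arcs H" "x \<in> ball_verts G v s"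
        "tail H e' = f x \<or> head H e' = f x"
        by (auto simp: arcs_rooted_ball simp flip: ball)
      moreover have "x \<in> verts G" using s ball_verts_subset[OF wf v] by blast
      ultimately obtain e where "e \<in> arcs G" "g e = e'" "tail G e = x \<or> head G e = x"
        using fib unfolding fibration_def by metis
      then show "e' \<in> g ` arcs (rooted_ball G v r)" using s by (auto simp: arcs_rooted_ball)
    qed
  qed
  ultimately have "iso_maps f g (rooted_ball G v r) v (rooted_ball H (f v) r) (f v)"
    using f ball hom sub by (auto simp: iso_maps_def bij_betw_def)
  then show ?thesis by (auto simp: balls_iso_iff)
qed


section \<open>Criteria for Benjamini--Schramm convergence\<close>

text \<open>An arc with one end in the component has both ends there, so passing to the component
  removes nothing from a ball. Thus components can be ignored once distances are expressed by
  balls.\<close>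

lemma rooted_ball_component:
  assumes "wf_digraph G" "v \<in> verts G"
  shows "rooted_ball (component G v) v r = rooted_ball G v r"
proof -
  let ?C = "component G v"
  have V: "verts ?C = {w. \<exists>r. w \<in> ball_verts G v r}"
    using assms by (simp add: component_def reachable_iff_ball)
  have th: "tail ?C = tail G" "head ?C = head G" by (auto simp: component_def)
  have "arcs ?C = {e \<in> arcs G. tail G e \<in> verts ?C \<and> head G e \<in> verts ?C}"
    by (auto simp: component_def induce_subgraph_def)
  then have A: "arcs ?C = {e \<in> arcs G. tail G e \<in> verts ?C \<or> head G e \<in> verts ?C}"
    using ball_verts_step[of _ G v] unfolding V by blast
  have B: "ball_verts ?C v r = ball_verts G v r" for r
  proof (induction r)
    case (Suc r)
    have "(x, y) \<in> parcs (mk_symmetric ?C) \<longleftrightarrow> (x, y) \<in> parcs (mk_symmetric G)"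
      if "x \<in> ball_verts G v r" for x y
      using that unfolding adj_iff th A V by blast
    then show ?case using Suc by (auto simp: ball_verts_Suc)
  qed simp
  have "arcs (rooted_ball ?C v r) = arcs (rooted_ball G v r)"
    unfolding arcs_rooted_ball B th A V by blast
  then show ?thesis by (intro pre_digraph.equality) (auto simp: B th)
qed

text \<open>The metric on classes is translated into balls of the original graphs: a representative
  is isomorphic to the component of the root, which has the same balls as the whole graph.\<close>

lemma dist_rooted_class_le_iff:
  assumes G: "wf_digraph G" "locally_finite G" "v \<in> verts G"
    and H: "wf_digraph H" "locally_finite H" "w \<in> verts H"
  shows "dist (rooted_class G v) (rooted_class H w) \<le> 1 / (1 + real r) \<longleftrightarrow> balls_iso G v H w r"
proof -
  obtain G' v' where G': "rooted_graph G' v'" "rooted_iso (component G v) v G' v'"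
    "rooted_class G v = abs_rgraph (G', v')" using rooted_classE[OF G] .
  obtain H' w' where H': "rooted_graph H' w'" "rooted_iso (component H w) w H' w'"
    "rooted_class H w = abs_rgraph (H', w')" using rooted_classE[OF H] .
  have "rgraph_rel (G', v') (G', v')" "rgraph_rel (H', w') (H', w')"
    using G' H' by (auto simp: rgraph_rel_def rooted_iso_refl rooted_graph_def)
  then have "dist (rooted_class G v) (rooted_class H w) = root_dist (G', v') (H', w')"
    using G' H' by (simp add: dist_rgraph.abs_eq)
  moreover have "balls_iso (component G v) v G' v' r" "balls_iso (component H w) w H' w' r"
    using rooted_graph_component[OF G] rooted_graph_component[OF H] G' H'
    by (auto simp: rooted_graph_def intro: rooted_iso_imp_balls_iso)
  then have "balls_iso G v G' v' r" "balls_iso H w H' w' r"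
    using G H by (auto simp: balls_iso_def rooted_ball_component)
  then have "balls_iso G' v' H' w' r \<longleftrightarrow> balls_iso G v H w r"
    by (meson balls_iso_trans balls_iso_sym)
  ultimately show ?thesis by (simp add: root_dist_le_iff)
qed

lemma transitive_graph_balls_iso:
  assumes "transitive_graph G" "v \<in> verts G" "w \<in> verts G"
  shows "balls_iso G v G w r"
  using assms by (auto simp: transitive_graph_def intro: rooted_iso_imp_balls_iso)

text \<open>Classes are defined through components. Instead of identifying a component with the
  whole graph, the proof compares their balls and recovers an isomorphism from the balls of all
  radii.\<close>

lemma transitive_graph_rooted_class:
  assumes "transitive_graph G" "v \<in> verts G" "w \<in> verts G"
  shows "rooted_class G v = rooted_class G w"
proof -
  have G: "wf_digraph G" "locally_finite G" using assms(1) by (auto simp: transitive_graph_def)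
  have "balls_iso (component G v) v (component G w) w r" for r
    using transitive_graph_balls_iso[OF assms, of r] assms G
    by (simp add: balls_iso_def rooted_ball_component)
  then have "rooted_iso (component G v) v (component G w) w"
    using assms G by (intro rooted_iso_of_balls_iso rooted_graph_component)
  then show ?thesis using assms G by (simp add: rooted_class_eq_iff)
qed

lemma integral_root_law:
  fixes f :: "rgraph \<Rightarrow> real"
  assumes "finite (verts G)" "verts G \<noteq> {}" "continuous_on UNIV f"
  shows "(\<integral>x. f x \<partial>root_law G) = (\<Sum>v \<in> verts G. f (rooted_class G v)) / real (card (verts G))"
proof -
  have "f \<in> borel_measurable borel" using assms(3) by (rule borel_measurable_continuous_onI)
  then have "(\<integral>x. f x \<partial>root_law G) =
      (\<integral>v. f (rooted_class G v) \<partial>uniform_count_measure (verts G))"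
    using assms(1) unfolding root_law_def
    by (subst if_P) (auto intro!: integral_distr simp: measurable_def space_uniform_count_measure sets_uniform_count_measure)
  also have "\<dots> = (\<Sum>v \<in> verts G. f (rooted_class G v)) / real (card (verts G))"
    unfolding uniform_count_measure_def
    using assms(1,2) by (simp add: lebesgue_integral_point_measure_finite sum_divide_distrib)
  finally show ?thesis .
qed

text \<open>A test function is nearly constant close to the limit point, which handles the roots
  whose \<open>r\<close>-ball is right. The other roots contribute at most twice the bound of the
  function times their proportion.\<close>

lemma bs_converges_finite:
  assumes G: "transitive_graph G" "w \<in> verts G"
    and fin: "\<forall>\<^sub>F i in F. fin_digraph (\<Gamma> i) \<and> verts (\<Gamma> i) \<noteq> {}"
    and bad: "\<And>r. ((\<lambda>i. real (card {v \<in> verts (\<Gamma> i). \<not> balls_iso (\<Gamma> i) v G w r}) /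
        real (card (verts (\<Gamma> i)))) \<longlongrightarrow> 0) F"
  shows "bs_converges \<Gamma> G F"
proof -
  let ?x = "rooted_class G w"
  have wfG: "wf_digraph G" "locally_finite G" using G by (auto simp: transitive_graph_def)
  have "weakly_converges (\<lambda>i. root_law (\<Gamma> i)) (return borel ?x) F"
    unfolding weakly_converges_def
  proof (intro allI impI)
    fix f :: "rgraph \<Rightarrow> real" assume cont: "continuous_on UNIV f" and "bounded (range f)"
    then obtain B where B: "\<And>y. \<bar>f y\<bar> \<le> B" by (auto simp: bounded_iff)
    have int: "(\<integral>x. f x \<partial>return borel ?x) = f ?x"
      using cont by (intro integral_return borel_measurable_continuous_onI) auto
    show "((\<lambda>i. \<integral>x. f x \<partial>root_law (\<Gamma> i)) \<longlongrightarrow> (\<integral>x. f x \<partial>return borel ?x)) F"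
      unfolding int
    proof (rule tendstoI)
      fix \<epsilon> :: real assume "\<epsilon> > 0"
      then have "\<exists>\<delta>>0. \<forall>y. dist y ?x < \<delta> \<longrightarrow> \<bar>f y - f ?x\<bar> < \<epsilon> / 2"
        using cont half_gt_zero[of \<epsilon>] unfolding continuous_on_iff dist_real_def by blast
      then obtain \<delta> where \<delta>: "\<delta> > 0" "\<And>y. dist y ?x < \<delta> \<Longrightarrow> \<bar>f y - f ?x\<bar> < \<epsilon> / 2"
        by blast
      \<comment> \<open>With this radius, isomorphic \<open>r\<close>-balls force the classes to be
        closer than \<delta>.\<close>
      obtain r where r: "1 / (1 + real r) < \<delta>"
        using \<delta>(1) by (metis nat_approx_posE of_nat_Suc)
      let ?B = "\<lambda>i. {v \<in> verts (\<Gamma> i). \<not> balls_iso (\<Gamma> i) v G w r}"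
      have "((\<lambda>i. 2 * B * (real (card (?B i)) / real (card (verts (\<Gamma> i))))) \<longlongrightarrow> 2 * B * 0) F"
        by (intro tendsto_mult_left bad)
      then have "\<forall>\<^sub>F i in F. 2 * B * (real (card (?B i)) / real (card (verts (\<Gamma> i)))) < \<epsilon> / 2"
        using \<open>\<epsilon> > 0\<close> by (intro order_tendstoD) auto
      then show "\<forall>\<^sub>F i in F. dist (\<integral>x. f x \<partial>root_law (\<Gamma> i)) (f ?x) < \<epsilon>"
        using fin
      proof eventually_elim
        case (elim i)
        let ?V = "verts (\<Gamma> i)"
        let ?f = "\<lambda>v. f (rooted_class (\<Gamma> i) v)"
        interpret fin_digraph "\<Gamma> i" using elim by simp
        have V: "finite ?V" "?V \<noteq> {}" "real (card ?V) > 0" using elim by auto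
        have lf: "locally_finite (\<Gamma> i)" by (auto simp: locally_finite_def)
        have "\<bar>?f v - f ?x\<bar> \<le> \<epsilon> / 2 + 2 * B * of_bool (v \<in> ?B i)" if v: "v \<in> ?V" for v
        proof (cases "v \<in> ?B i")
          case True
          then show ?thesis using B[of "rooted_class (\<Gamma> i) v"] B[of ?x] \<open>\<epsilon> > 0\<close> by auto
        next
          case False
          then have "dist (rooted_class (\<Gamma> i) v) ?x \<le> 1 / (1 + real r)"
            using v wfG G(2) lf wf_digraph_axioms by (simp add: dist_rooted_class_le_iff)
          then show ?thesis using r \<delta>(2)[of "rooted_class (\<Gamma> i) v"] False by auto
        qed
        then have "(\<Sum>v \<in> ?V. \<bar>?f v - f ?x\<bar>) \<le> (\<Sum>v \<in> ?V. \<epsilon> / 2 + 2 * B * of_bool (v \<in> ?B i))"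
          by (rule sum_mono)
        also have "\<dots> = real (card ?V) * (\<epsilon> / 2) + 2 * B * real (card (?B i))"
        proof -
          have "(\<Sum>v \<in> ?V. of_bool (v \<in> ?B i) :: real) = real (card (?B i))"
            using V(1) by (simp add: sum.If_cases of_bool_def Int_def cong: conj_cong)
          then show ?thesis by (simp add: sum.distrib flip: sum_distrib_left)
        qed
        finally have *: "(\<Sum>v \<in> ?V. \<bar>?f v - f ?x\<bar>) \<le>
          real (card ?V) * (\<epsilon> / 2) + 2 * B * real (card (?B i))" .
        have "(\<integral>x. f x \<partial>root_law (\<Gamma> i)) - f ?x = (\<Sum>v \<in> ?V. ?f v - f ?x) / real (card ?V)"
          using V cont by (simp add: integral_root_law sum_subtractf field_simps)
        then have "\<bar>(\<integral>x. f x \<partial>root_law (\<Gamma> i)) - f ?x\<bar> \<le>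
          (\<Sum>v \<in> ?V. \<bar>?f v - f ?x\<bar>) / real (card ?V)"
          by (simp add: sum_abs divide_right_mono)
        also have "\<dots> \<le> \<epsilon> / 2 + 2 * B * (real (card (?B i)) / real (card ?V))"
          using * V(3) by (simp add: field_simps)
        also have "\<dots> < \<epsilon>" using elim by simp
        finally show ?case by (simp add: dist_real_def)
      qed
    qed
  qed
  then have "weakly_converges (\<lambda>i. root_law (\<Gamma> i)) (return borel (rooted_class G v)) F"
    if "v \<in> verts G" for v
    using transitive_graph_rooted_class[OF G(1) that G(2)] by metis
  then show ?thesis
    using G(1) fin by (auto simp: bs_converges_def has_root_law_def elim: eventually_mono)
qed

text \<open>Infinite vertex sets put \<open>root_law\<close> in its Dirac branch, so the laws
  converge as soon as the classes do. By transitivity a single root per graph decides the distance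
  to the limit.\<close>

lemma bs_converges_transitive:
  assumes G: "transitive_graph G" "w \<in> verts G"
    and tr: "\<forall>\<^sub>F i in F. transitive_graph (\<Gamma> i) \<and> infinite (verts (\<Gamma> i))"
    and iso: "\<And>r. \<forall>\<^sub>F i in F. \<exists>v \<in> verts (\<Gamma> i). balls_iso (\<Gamma> i) v G w r"
  shows "bs_converges \<Gamma> G F"
proof -
  let ?x = "rooted_class G w" and ?y = "\<lambda>i. rooted_class (\<Gamma> i) (SOME v. v \<in> verts (\<Gamma> i))"
  have wfG: "wf_digraph G" "locally_finite G" using G by (auto simp: transitive_graph_def)
  have y: "(?y \<longlongrightarrow> ?x) F"
  proof (rule tendstoI)
    fix \<epsilon> :: real assume "\<epsilon> > 0"
    then obtain r where r: "1 / (1 + real r) < \<epsilon>" by (metis nat_approx_posE of_nat_Suc)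
    show "\<forall>\<^sub>F i in F. dist (?y i) ?x < \<epsilon>"
      using tr iso[of r]
    proof eventually_elim
      case (elim i)
      then obtain v where v: "v \<in> verts (\<Gamma> i)" "balls_iso (\<Gamma> i) v G w r" by blast
      have u: "(SOME v. v \<in> verts (\<Gamma> i)) \<in> verts (\<Gamma> i)" using v(1) by (rule someI)
      have "dist (rooted_class (\<Gamma> i) v) ?x \<le> 1 / (1 + real r)"
        using v wfG G elim by (subst dist_rooted_class_le_iff) (auto simp: transitive_graph_def)
      then show ?case using transitive_graph_rooted_class[of "\<Gamma> i", OF _ u v(1)] elim r by simp
    qed
  qed
  have "weakly_converges (\<lambda>i. root_law (\<Gamma> i)) (return borel ?x) F"
    unfolding weakly_converges_def
  proof (intro allI impI)
    fix f :: "rgraph \<Rightarrow> real" assume cont: "continuous_on UNIV f"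
    have int: "(\<integral>z. f z \<partial>return borel u) = f u" for u
      using cont by (intro integral_return borel_measurable_continuous_onI) auto
    have "((\<lambda>i. f (?y i)) \<longlongrightarrow> f ?x) F"
      using cont y by (intro isCont_tendsto_compose[of _ f]) (auto simp: continuous_on_eq_continuous_at)
    moreover have "\<forall>\<^sub>F i in F. f (?y i) = (\<integral>x. f x \<partial>root_law (\<Gamma> i))"
      using tr by eventually_elim (simp add: root_law_def int)
    ultimately show "((\<lambda>i. \<integral>x. f x \<partial>root_law (\<Gamma> i)) \<longlongrightarrow> (\<integral>x. f x \<partial>return borel ?x)) F"
      unfolding int by (rule Lim_transform_eventually)
  qed
  then have "weakly_converges (\<lambda>i. root_law (\<Gamma> i)) (return borel (rooted_class G v)) F"
    if "v \<in> verts G" for v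
    using transitive_graph_rooted_class[OF G(1) that G(2)] by metis
  then show ?thesis
    using G(1) tr by (auto simp: bs_converges_def has_root_law_def elim: eventually_mono)
qed


section \<open>Cayley graphs and the lamplighter group\<close>

lemma cayley_graph_sel [simp]:
  "verts (cayley_graph G X) = carrier G"
  "arcs (cayley_graph G X) = carrier G \<times> X"
  "tail (cayley_graph G X) (v, x) = v"
  "head (cayley_graph G X) (v, x) = v \<otimes>\<^bsub>G\<^esub> x"
  by (auto simp: cayley_graph_def)

lemma wf_cayley_graph:
  assumes "group G" "X \<subseteq> carrier G"
  shows "wf_digraph (cayley_graph G X)"
proof -
  interpret group G by fact
  show ?thesis using assms(2) by unfold_locales (auto simp: cayley_graph_def)
qed

lemma locally_finite_cayley_graph:
  assumes "group G" "X \<subseteq> carrier G" "finite X"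
  shows "locally_finite (cayley_graph G X)"
proof -
  interpret group G by fact
  have "finite (out_arcs (cayley_graph G X) v)" "finite (in_arcs (cayley_graph G X) v)"
    if "v \<in> carrier G" for v
  proof -
    have "out_arcs (cayley_graph G X) v \<subseteq> {v} \<times> X"
      by (auto simp: cayley_graph_def out_arcs_def)
    then show "finite (out_arcs (cayley_graph G X) v)"
      using assms(3) by (auto intro: finite_subset)
    have "in_arcs (cayley_graph G X) v \<subseteq> (\<lambda>x. (v \<otimes>\<^bsub>G\<^esub> inv\<^bsub>G\<^esub> x, x)) ` X"
      using assms(2) by (auto simp: cayley_graph_def in_arcs_def image_iff m_assoc subset_iff)
    then show "finite (in_arcs (cayley_graph G X) v)"
      using assms(3) by (auto intro: finite_subset)
  qed
  then show ?thesis by (auto simp: locally_finite_def cayley_graph_def)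
qed

text \<open>Arcs multiply on the right, so left multiplication by \<open>w\<close> times the inverse
  of \<open>v\<close> is an automorphism that takes \<open>v\<close> to \<open>w\<close>.\<close>

lemma transitive_cayley_graph:
  assumes G: "group G" and X: "X \<subseteq> carrier G" "finite X"
    and conn: "Digraph_Component.connected (cayley_graph G X)"
  shows "transitive_graph (cayley_graph G X)"
proof -
  interpret group G by fact
  have "rooted_iso (cayley_graph G X) v (cayley_graph G X) w"
    if vw: "v \<in> carrier G" "w \<in> carrier G" for v w
  proof -
    let ?h = "w \<otimes>\<^bsub>G\<^esub> inv\<^bsub>G\<^esub> v"
    have h: "?h \<in> carrier G" "?h \<otimes>\<^bsub>G\<^esub> v = w" using vw by (auto simp: m_assoc)
    have "bij_betw (\<lambda>x. ?h \<otimes>\<^bsub>G\<^esub> x) (carrier G) (carrier G)"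
      using h(1) by (intro bij_betw_byWitness[where f' = "\<lambda>x. inv\<^bsub>G\<^esub> ?h \<otimes>\<^bsub>G\<^esub> x"])
        (auto simp flip: m_assoc)
    moreover from bij_betw_map_prod[OF this bij_betw_id[of X]]
    have "bij_betw (map_prod (\<lambda>x. ?h \<otimes>\<^bsub>G\<^esub> x) id) (carrier G \<times> X) (carrier G \<times> X)" .
    ultimately have "iso_maps (\<lambda>x. ?h \<otimes>\<^bsub>G\<^esub> x) (map_prod (\<lambda>x. ?h \<otimes>\<^bsub>G\<^esub> x) id)
        (cayley_graph G X) v (cayley_graph G X) w"
      using h X by (auto simp: iso_maps_def cayley_graph_def m_assoc subset_iff)
    then show ?thesis using wf_cayley_graph[OF G X(1)] by (auto simp: rooted_iso_iff)
  qed
  then show ?thesis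
    using wf_cayley_graph[OF G X(1)] locally_finite_cayley_graph[OF G X] conn
    by (auto simp: transitive_graph_def cayley_graph_def)
qed

section \<open>The lamplighter Cayley graph in coordinates\<close>

definition lamp_gen :: "nat \<Rightarrow> (int \<Rightarrow> int) \<times> int" where
  "lamp_gen r = ((\<lambda>i. if i = 0 then int r else 0), 1)"

lemma mem_lamplighter_iff:
  assumes "k > 0"
  shows "(f, m) \<in> carrier (lamplighter k) \<longleftrightarrow>
    (\<forall>i. 0 \<le> f i \<and> f i < int k) \<and> finite {i. f i \<noteq> 0}"
  using assms by (auto simp: lamplighter_def carrier_lamp_configs carrier_integer_mod_group)

lemma lamp_gens_eq:
  assumes "k \<ge> 2"
  shows "lamp_gens k = lamp_gen ` {..<k}"
proof -
  have "lamp_c [^]\<^bsub>lamplighter k\<^esub> r = ((\<lambda>i. if i = 0 then int r mod int k else 0), 0)" for r :: nat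
  proof (induction r)
    case (Suc r)
    then show ?case
      by (auto simp: lamplighter_def mult_lamp_configs lamp_c_def nat_pow_Suc fun_eq_iff mod_simps)
        (simp add: add.commute)
  qed (auto simp: lamplighter_def one_lamp_configs nat_pow_0)
  then have "lamp_c [^]\<^bsub>lamplighter k\<^esub> r \<otimes>\<^bsub>lamplighter k\<^esub> lamp_b k = lamp_gen r" if "r < k" for r
    using that
    by (auto simp: lamplighter_def lamp_b_def lamp_gen_def mult_lamp_configs one_lamp_configs fun_eq_iff)
  then show ?thesis unfolding lamp_gens_def by (intro image_cong) auto
qed

lemma lamp_gens_carrier:
  assumes "k \<ge> 2"
  shows "lamp_gens k \<subseteq> carrier (lamplighter k)"
  using assms by (auto simp: lamp_gens_eq lamp_gen_def mem_lamplighter_iff)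

lemma lamplighter_mult_gen:
  assumes "k > 0" "(f, m) \<in> carrier (lamplighter k)"
  shows "(f, m) \<otimes>\<^bsub>lamplighter k\<^esub> lamp_gen r = (f(m := (f m + int r) mod int k), m + 1)"
proof -
  have "f i mod int k = f i" for i using assms by (simp add: mem_lamplighter_iff)
  then show ?thesis by (auto simp: lamp_gen_def lamplighter_def mult_lamp_configs fun_eq_iff)
qed

abbreviation lamp_cayley :: "nat \<Rightarrow> ((int \<Rightarrow> int) \<times> int, ((int \<Rightarrow> int) \<times> int) \<times> (int \<Rightarrow> int) \<times> int) pre_digraph"
  where "lamp_cayley k \<equiv> cayley_graph (lamplighter k) (lamp_gens k)"

lemma lamp_cayley_arcE:
  assumes "k \<ge> 2" "e \<in> arcs (lamp_cayley k)"
  obtains f m r where "e = ((f, m), lamp_gen r)" "r < k" "(f, m) \<in> carrier (lamplighter k)"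
    "tail (lamp_cayley k) e = (f, m)"
    "head (lamp_cayley k) e = (f(m := (f m + int r) mod int k), m + 1)"
proof -
  obtain f m r where e: "e = ((f, m), lamp_gen r)" "r < k" "(f, m) \<in> carrier (lamplighter k)"
    using assms by (auto simp: lamp_gens_eq)
  with that[OF this] show thesis using assms(1) by (simp add: lamplighter_mult_gen)
qed

lemma lamp_cayley_arcI:
  assumes "k \<ge> 2" "(f, m) \<in> carrier (lamplighter k)" "r < k"
  shows "((f, m), lamp_gen r) \<in> arcs (lamp_cayley k)"
  using assms by (auto simp: lamp_gens_eq)

lemma wf_lamp_cayley: "k \<ge> 2 \<Longrightarrow> wf_digraph (lamp_cayley k)"
  by (intro wf_cayley_graph group_lamplighter lamp_gens_carrier)

lemma zero_lamplighter: "k > 0 \<Longrightarrow> ((\<lambda>_. 0), m) \<in> carrier (lamplighter k)"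
  by (simp add: mem_lamplighter_iff)

lemma connected_if_rtrancl:
  assumes "wf_digraph G" "v \<in> verts G"
    and "\<And>w. w \<in> verts G \<Longrightarrow> (v, w) \<in> (parcs (mk_symmetric G))\<^sup>*"
  shows "Digraph_Component.connected G"
  unfolding connected_iff_ball[OF assms(1,2)]
proof
  fix w assume "w \<in> verts G"
  then obtain n where "(v, w) \<in> parcs (mk_symmetric G) ^^ n"
    using assms(3) by (meson rtrancl_imp_relpow)
  then show "\<exists>r. w \<in> ball_verts G v r" by (auto simp: ball_verts_def)
qed

text \<open>In the underlying non-oriented graph one can walk to any lamp without changing the
  configuration, turn it off and walk back. Finitely many such excursions lead to the
  identity.\<close>

lemma connected_lamp_cayley:
  assumes k: "k \<ge> 2"
  shows "Digraph_Component.connected (lamp_cayley k)"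
proof (rule connected_if_rtrancl[OF wf_lamp_cayley[OF k]])
  let ?R = "parcs (mk_symmetric (lamp_cayley k))" and ?C = "carrier (lamplighter k)"
  have sym: "sym (?R\<^sup>*)" by (intro sym_rtrancl symI) (auto simp: adj_iff)
  have step: "((f, m), (f(m := (f m + int r) mod int k), m + 1)) \<in> ?R"
    if "(f, m) \<in> ?C" "r < k" for f m r
    unfolding adj_iff using lamp_cayley_arcI[OF k that] that k
    by (intro bexI[of _ "((f, m), lamp_gen r)"]) (auto simp: lamplighter_mult_gen)
  \<comment> \<open>The generator with \<open>r = 0\<close> moves up without touching a
    lamp.\<close>
  have up: "((f, m), (f, m + int n)) \<in> ?R\<^sup>*" if "(f, m) \<in> ?C" for f m n
  proof (induction n)
    case (Suc n)
    have "(f, m + int n) \<in> ?C" using that k by (simp add: mem_lamplighter_iff)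
    from step[OF this, of 0] have "((f, m + int n), (f, m + int (Suc n))) \<in> ?R"
      using that k by (simp add: mem_lamplighter_iff add.commute add.left_commute)
    then show ?case using Suc by (rule rtrancl_into_rtrancl[rotated])
  qed simp
  have move: "((f, m), (f, m')) \<in> ?R\<^sup>*" if f: "(f, m) \<in> ?C" for f m m'
  proof (cases "m \<le> m'")
    case True
    then show ?thesis using up[OF f, of "nat (m' - m)"] by simp
  next
    case False
    moreover have "(f, m') \<in> ?C" using f k by (simp add: mem_lamplighter_iff)
    ultimately show ?thesis using up[of f m' "nat (m - m')"] by (simp add: symD[OF sym])
  qed
  have upd: "((f, m), (f(j := 0), m)) \<in> ?R\<^sup>*" if f: "(f, m) \<in> ?C" for f m j
  proof -
    have fj: "(f, j) \<in> ?C" using f k by (simp add: mem_lamplighter_iff)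
    have "{i. (f(j := 0)) i \<noteq> 0} \<subseteq> {i. f i \<noteq> 0}" by auto
    then have fj': "(f(j := 0), j + 1) \<in> ?C"
      using f k by (auto simp: mem_lamplighter_iff intro: finite_subset)
    \<comment> \<open>This is the amount that turns the lamp at \<open>j\<close> off.\<close>
    have "nat ((- f j) mod int k) < k" using k by (simp add: nat_less_iff)
    from step[OF fj this] have "((f, j), (f(j := 0), j + 1)) \<in> ?R"
      using k by (simp add: mod_simps)
    then show ?thesis
      using move[OF f, of j] move[OF fj', of m] by (meson rtrancl.rtrancl_into_rtrancl rtrancl_trans)
  qed
  \<comment> \<open>The set \<open>S\<close> only has to contain the support, so the induction may
    remove a point whether or not its lamp is on.\<close>
  have zero: "((f, m), ((\<lambda>_. 0), 0)) \<in> ?R\<^sup>*"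
    if "finite S" "(f, m) \<in> ?C" "{i. f i \<noteq> 0} \<subseteq> S" for S f m
    using that
  proof (induction S arbitrary: f rule: finite_induct)
    case empty
    then have "f = (\<lambda>_. 0)" by auto
    then show ?case using move empty by blast
  next
    case (insert j S)
    have "{i. (f(j := 0)) i \<noteq> 0} \<subseteq> {i. f i \<noteq> 0}" by auto
    then have "(f(j := 0), m) \<in> ?C"
      using insert.prems k by (auto simp: mem_lamplighter_iff intro: finite_subset)
    moreover have "{i. (f(j := 0)) i \<noteq> 0} \<subseteq> S" using insert.prems by auto
    ultimately have "((f(j := 0), m), ((\<lambda>_. 0), 0)) \<in> ?R\<^sup>*" by (rule insert.IH)
    then show ?case using upd[OF insert.prems(1), of j] by (rule rtrancl_trans[rotated])
  qed
  show "((\<lambda>_. 0), 0) \<in> verts (lamp_cayley k)" using k by (simp add: zero_lamplighter)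
  show "(((\<lambda>_. 0), 0), w) \<in> ?R\<^sup>*" if C: "w \<in> verts (lamp_cayley k)" for w
  proof -
    obtain f m where w: "w = (f, m)" "(f, m) \<in> ?C"
      using C by (cases w) auto
    moreover have "finite {i. f i \<noteq> 0}" using w k by (auto simp: mem_lamplighter_iff)
    ultimately show ?thesis using zero[of "{i. f i \<noteq> 0}" f m] by (simp add: symD[OF sym])
  qed
qed

lemma transitive_lamp_cayley: "k \<ge> 2 \<Longrightarrow> transitive_graph (lamp_cayley k)"
  by (intro transitive_cayley_graph group_lamplighter lamp_gens_carrier connected_lamp_cayley)
    (auto simp: lamp_gens_def)

text \<open>An arc between levels \<open>l\<close> and \<open>l + 1\<close> rewrites only the lamp
  at \<open>l\<close>, and a walk of length at most \<open>r\<close> from level \<open>i\<close>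
  uses only arcs with \<open>i - r \<le> l < i + r\<close>.\<close>

lemma lamp_cayley_ball:
  assumes k: "k \<ge> 2" and "(f, m) \<in> ball_verts (lamp_cayley k) (f0, i) r"
  shows "\<bar>m - i\<bar> \<le> int r" "j < i - int r \<or> i + int r \<le> j \<Longrightarrow> f j = f0 j"
proof -
  have "\<bar>m - i\<bar> \<le> int r \<and> (\<forall>j. j < i - int r \<or> i + int r \<le> j \<longrightarrow> f j = f0 j)"
    using assms(2)
  proof (induction r arbitrary: f m)
    case (Suc r)
    then consider "(f, m) \<in> ball_verts (lamp_cayley k) (f0, i) r"
      | g n e where "(g, n) \<in> ball_verts (lamp_cayley k) (f0, i) r" "e \<in> arcs (lamp_cayley k)"
        "{tail (lamp_cayley k) e, head (lamp_cayley k) e} = {(g, n), (f, m)}"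
      by (fastforce simp: ball_verts_Suc adj_iff)
    then show ?case
    proof cases
      case 1
      then show ?thesis using Suc.IH[of f m] by force
    next
      case 2
      note IH = Suc.IH[OF 2(1)]
      from 2(2) show ?thesis
      proof (rule lamp_cayley_arcE[OF k])
        fix h l a
        assume "tail (lamp_cayley k) e = (h, l)"
          "head (lamp_cayley k) e = (h(l := (h l + int a) mod int k), l + 1)"
        \<comment> \<open>The rewritten lamp is at the lower of the two levels in either direction
          of travel.\<close>
        then have "l = min m n" "\<bar>m - n\<bar> = 1" and eq: "j \<noteq> l \<Longrightarrow> f j = g j" for j
          using 2(3) by (auto simp: doubleton_eq_iff)
        moreover from this IH have "\<bar>m - i\<bar> \<le> int (Suc r)" "i - int (Suc r) \<le> l" "l < i + int (Suc r)"
          by linarith+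
        moreover have "g j = f0 j" if "j < i - int (Suc r) \<or> i + int (Suc r) \<le> j" for j
          using IH that by auto
        ultimately show ?thesis by (metis leD)
      qed
    qed
  qed auto
  then show "\<bar>m - i\<bar> \<le> int r" "j < i - int r \<or> i + int r \<le> j \<Longrightarrow> f j = f0 j" by auto
qed


section \<open>Spider-web graphs\<close>

text \<open>\<open>integer_mod_group 0\<close> is infinite cyclic, so \<open>M = 0\<close> stands for \<open>M = \<infinity>\<close> from here on.\<close>

lemma spider_web_infinity: "spider_web k N \<infinity> = spider_web k N (enat 0)"
  by (simp add: spider_web_def level_group_def integer_mod_group_def)

text \<open>Since \<open>i mod 0 = i\<close>, this description of the levels is uniform in finite
  and infinite \<open>M\<close>.\<close>

lemma carrier_integer_mod_group_iff: "i \<in> carrier (integer_mod_group m) \<longleftrightarrow> i mod int m = i"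
proof (cases "m = 0")
  case False
  then have "i mod int m = i \<longleftrightarrow> 0 \<le> i \<and> i < int m"
    by (metis mod_pos_pos_trivial of_nat_0_less_iff pos_mod_bound pos_mod_sign zero_less_iff_neq_zero)
  then show ?thesis using False by (simp add: carrier_integer_mod_group)
qed (simp add: carrier_integer_mod_group)

definition words :: "nat \<Rightarrow> nat \<Rightarrow> nat list set" where
  "words k N = {x. set x \<subseteq> {..<k} \<and> length x = N}"

lemma finite_words: "finite (words k N)"
  by (simp add: words_def finite_lists_length_eq)

lemma card_words: "card (words k N) = k ^ N"
  by (simp add: words_def card_lists_length_eq)

lemma spider_web_sel [simp]:
  "verts (spider_web k N (enat m)) = words k N \<times> {i. i mod int m = i}"
  "arcs (spider_web k N (enat m)) = (words k N \<times> {i. i mod int m = i}) \<times> {..<k}"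
  "tail (spider_web k N (enat m)) = fst"
  "head (spider_web k N (enat m)) = (\<lambda>((x, i), y). (tl (x @ [y]), (i + 1) mod int m))"
  by (auto simp: spider_web_def level_group_def words_def Let_def simp flip: carrier_integer_mod_group_iff)

lemma words_shift: "x \<in> words k N \<Longrightarrow> y < k \<Longrightarrow> tl (x @ [y]) \<in> words k N"
  by (cases x) (auto simp: words_def)

lemma wf_spider_web: "wf_digraph (spider_web k N (enat m))"
  by unfold_locales (auto intro: words_shift)

lemma mod_pred_eq:
  fixes i j m :: int
  assumes "(j + 1) mod m = i" "j mod m = j"
  shows "j = (i - 1) mod m"
  using assms by (metis add_diff_cancel_right' mod_diff_left_eq)

lemma locally_finite_spider_web: "locally_finite (spider_web k N (enat m))"
proof -
  let ?G = "spider_web k N (enat m)"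
  have "finite (out_arcs ?G v)" "finite (in_arcs ?G v)" for v
  proof -
    have "out_arcs ?G v \<subseteq> {v} \<times> {..<k}" by (auto simp: out_arcs_def)
    then show "finite (out_arcs ?G v)" by (auto intro: finite_subset)
    have "in_arcs ?G v \<subseteq> (words k N \<times> {(snd v - 1) mod int m}) \<times> {..<k}"
      by (auto simp: in_arcs_def intro: mod_pred_eq)
    then show "finite (in_arcs ?G v)" by (rule finite_subset) (simp add: finite_words)
  qed
  then show ?thesis by (simp add: locally_finite_def)
qed

lemma levels_eq: "m > 0 \<Longrightarrow> {i. i mod int m = i} = {0..<int m}"
  by (auto simp: carrier_integer_mod_group simp flip: carrier_integer_mod_group_iff)

lemma fin_digraph_spider_web:
  assumes "m > 0"
  shows "fin_digraph (spider_web k N (enat m))"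
proof -
  interpret wf_digraph "spider_web k N (enat m)" by (rule wf_spider_web)
  show ?thesis by unfold_locales (use assms in \<open>auto simp: finite_words levels_eq\<close>)
qed

lemma replicate_in_words: "k > 0 \<Longrightarrow> replicate N 0 \<in> words k N"
  by (auto simp: words_def)

section \<open>The map from the lamplighter graph to spider-web graphs\<close>

definition lamp_word :: "nat \<Rightarrow> nat \<Rightarrow> nat \<Rightarrow> (int \<Rightarrow> int) \<times> int \<Rightarrow> nat list \<times> int" where
  "lamp_word k N M = (\<lambda>(f, m).
     (map (\<lambda>t. nat ((f (m + int t) + f (m + int t - int N)) mod int k)) [0..<N], m mod int M))"

text \<open>The value \<open>g 0\<close> recovers \<open>r\<close> from \<open>lamp_gen r\<close>.
  The number computed is the letter at \<open>m + N\<close> after the lamp at \<open>m\<close> has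
  been raised by \<open>r\<close>, that is, the letter to be appended.\<close>

definition lamp_label ::
    "nat \<Rightarrow> nat \<Rightarrow> nat \<Rightarrow> ((int \<Rightarrow> int) \<times> int) \<times> (int \<Rightarrow> int) \<times> int \<Rightarrow> (nat list \<times> int) \<times> nat" where
  "lamp_label k N M = (\<lambda>((f, m), (g, n)).
     (lamp_word k N M (f, m), nat ((f (m + int N) + f m + g 0) mod int k)))"

lemma lamp_word_hom:
  assumes k: "k \<ge> 2" and e: "e \<in> arcs (lamp_cayley k)"
  shows "lamp_label k N M e \<in> arcs (spider_web k N (enat M)) \<and>
    tail (spider_web k N (enat M)) (lamp_label k N M e) = lamp_word k N M (tail (lamp_cayley k) e) \<and>
    head (spider_web k N (enat M)) (lamp_label k N M e) = lamp_word k N M (head (lamp_cayley k) e)"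
proof -
  obtain f m r where e': "e = ((f, m), lamp_gen r)" "r < k" "(f, m) \<in> carrier (lamplighter k)"
    and th: "tail (lamp_cayley k) e = (f, m)"
      "head (lamp_cayley k) e = (f(m := (f m + int r) mod int k), m + 1)"
    using lamp_cayley_arcE[OF k e] .
  let ?w = "map (\<lambda>t. nat ((f (m + int t) + f (m + int t - int N)) mod int k)) [0..<N]"
  let ?y = "nat ((f (m + int N) + f m + int r) mod int k)"
  have lab: "lamp_label k N M e = ((?w, m mod int M), ?y)"
    by (simp add: e' lamp_label_def lamp_word_def lamp_gen_def)
  have nat_k: "nat (a mod int k) < k" for a using k by (simp add: nat_less_iff)
  have "tl (?w @ [?y]) = fst (lamp_word k N M (f(m := (f m + int r) mod int k), m + 1))"
  proof (rule nth_equalityI)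
    show "length (tl (?w @ [?y])) = length (fst (lamp_word k N M (f(m := (f m + int r) mod int k), m + 1)))"
      by (simp add: lamp_word_def)
    fix t assume "t < length (tl (?w @ [?y]))"
    then have t: "t < N" by simp
    \<comment> \<open>Only the last letter of the new word reads the rewritten lamp at
      \<open>m\<close>; the other letters are merely shifted.\<close>
    show "tl (?w @ [?y]) ! t = fst (lamp_word k N M (f(m := (f m + int r) mod int k), m + 1)) ! t"
    proof (cases "Suc t < N")
      case True
      then show ?thesis
        using t by (simp add: nth_tl nth_append lamp_word_def add.assoc algebra_simps)
    next
      case False
      then have "N = Suc t" using t by simp
      then show ?thesis
        by (simp add: nth_tl nth_append lamp_word_def mod_simps algebra_simps)
    qed
  qed
  then show ?thesis
    unfolding th lab by (auto simp: lamp_word_def words_def nat_k mod_simps)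
qed

text \<open>The lamps of \<open>f\<close> are off outside the window from \<open>i\<close> to
  \<open>i + N - 1\<close>, so the second summand of each letter vanishes and the word is read off
  directly.\<close>

lemma lamp_word_surj:
  assumes k: "k > 0" and x: "x \<in> words k N" "i mod int M = i"
  defines "f \<equiv> (\<lambda>j. if i \<le> j \<and> j < i + int N then int (x ! nat (j - i)) else 0)"
  shows "(f, i) \<in> carrier (lamplighter k)" "lamp_word k N M (f, i) = (x, i)"
proof -
  have x': "length x = N" "\<And>t. t < N \<Longrightarrow> x ! t < k" using x by (auto simp: words_def subset_iff)
  have "{j. f j \<noteq> 0} \<subseteq> {i..<i + int N}" by (auto simp: f_def)
  moreover have "0 \<le> f j \<and> f j < int k" for j
    using x'(2)[of "nat (j - i)"] k by (auto simp: f_def)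
  ultimately show "(f, i) \<in> carrier (lamplighter k)"
    using k by (auto simp: mem_lamplighter_iff intro: finite_subset)
  show "lamp_word k N M (f, i) = (x, i)"
    using x x' by (auto simp: lamp_word_def f_def intro!: nth_equalityI)
qed

text \<open>A surjective homomorphic image of a connected graph is connected.\<close>

lemma connected_spider_web:
  assumes k: "k \<ge> 2"
  shows "Digraph_Component.connected (spider_web k N (enat M))"
proof -
  let ?G = "spider_web k N (enat M)" and ?u = "((\<lambda>_. 0), 0) :: (int \<Rightarrow> int) \<times> int"
  have v: "?u \<in> verts (lamp_cayley k)" using k by (simp add: zero_lamplighter)
  have "lamp_word k N M ?u = (replicate N 0, 0)"
    by (auto simp: lamp_word_def intro: nth_equalityI)
  then have u: "lamp_word k N M ?u \<in> verts ?G" using k by (simp add: replicate_in_words)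
  show ?thesis unfolding connected_iff_ball[OF wf_spider_web u]
  proof
    fix w assume "w \<in> verts ?G"
    then obtain z where z: "z \<in> verts (lamp_cayley k)" "lamp_word k N M z = w"
      using lamp_word_surj[of k _ N] k by fastforce
    then obtain r where "z \<in> ball_verts (lamp_cayley k) ?u r"
      using connected_lamp_cayley[OF k] connected_iff_ball[OF wf_lamp_cayley[OF k] v] by blast
    then have "lamp_word k N M z \<in> ball_verts ?G (lamp_word k N M ?u) r"
      using lamp_word_hom[OF k] by (rule hom_ball_verts[rotated])
    then show "\<exists>r. w \<in> ball_verts ?G (lamp_word k N M ?u) r" using z by auto
  qed
qed

text \<open>Both summands of a letter are needed for the lifting. With \<open>f j\<close> alone the
  appended letter would be fixed in advance, so outgoing arcs would not lift. With
  \<open>f (j - N)\<close> alone the first letter of the preceding word would be fixed, so incoming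
  arcs would not lift.\<close>

lemma fibration_lamp_word:
  assumes k: "k \<ge> 2" and N: "N \<ge> 1"
  shows "fibration (lamp_word k N M) (lamp_label k N M) (lamp_cayley k) (spider_web k N (enat M))"
  unfolding fibration_def
proof (intro conjI ballI impI)
  let ?C = "lamp_cayley k" and ?G = "spider_web k N (enat M)"
  fix v e' assume v: "v \<in> verts ?C" and e': "e' \<in> arcs ?G"
  obtain f m where fm: "v = (f, m)" by (cases v)
  obtain w i y where e'_eq: "e' = ((w, i), y)" and y: "y < k" and w: "w \<in> words k N" and i: "i mod int M = i"
    using e' by auto
  have w': "length w = N" "\<And>t. t < N \<Longrightarrow> w ! t < k" using w by (auto simp: words_def subset_iff)
  have nat_k: "nat (a mod int k) < k" for a using k by (simp add: nat_less_iff)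
  show "\<exists>e \<in> arcs ?C. lamp_label k N M e = e' \<and> tail ?C e = v" if tl: "tail ?G e' = lamp_word k N M v"
  proof -
    \<comment> \<open>The solution \<open>r\<close> of \<open>f (m + N) + f m + r = y\<close> modulo
      \<open>k\<close>.\<close>
    let ?r = "nat ((int y - f (m + int N) - f m) mod int k)"
    have "(f (m + int N) + f m + (int y - f (m + int N) - f m) mod int k) mod int k = int y mod int k"
      by (simp add: mod_simps)
    then have "lamp_label k N M (v, lamp_gen ?r) = e'"
      using tl y k by (simp add: lamp_label_def lamp_gen_def fm e'_eq)
    then show ?thesis
      using v fm lamp_cayley_arcI[OF k _ nat_k] by (intro bexI[of _ "(v, lamp_gen ?r)"]) auto
  qed
  show "\<exists>e \<in> arcs ?C. lamp_label k N M e = e' \<and> head ?C e = v" if hd: "head ?G e' = lamp_word k N M v"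
  proof -
    have wy: "tl (w @ [y]) = fst (lamp_word k N M (f, m))" and lev: "(i + 1) mod int M = m mod int M"
      using hd by (auto simp: fm e'_eq lamp_word_def)
    \<comment> \<open>The case \<open>t = N - 1\<close> is included; there it computes the label
      \<open>y\<close>.\<close>
    have letter: "(w @ [y]) ! Suc t = nat ((f (m + int t) + f (m + int t - int N)) mod int k)"
      if "t < N" for t
    proof -
      have "(w @ [y]) ! Suc t = tl (w @ [y]) ! t" using that w' by (simp add: nth_tl)
      also have "\<dots> = nat ((f (m + int t) + f (m + int t - int N)) mod int k)"
        unfolding wy using that by (simp add: lamp_word_def)
      finally show ?thesis .
    qed
    \<comment> \<open>The lamp at \<open>m - 1\<close> before the arc is forced by the first letter
      of \<open>w\<close>; then \<open>r\<close> has to raise it from \<open>b\<close> to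
      \<open>f (m - 1)\<close>.\<close>
    define b where "b = (int (w ! 0) - f (m - 1 - int N)) mod int k"
    define r where "r = nat ((f (m - 1) - b) mod int k)"
    let ?f = "f(m - 1 := b)"
    have f: "0 \<le> f j" "f j < int k" for j
      using v k by (auto simp: fm mem_lamplighter_iff)
    have "{i. ?f i \<noteq> 0} \<subseteq> insert (m - 1) {i. f i \<noteq> 0}" by auto
    moreover have "0 \<le> b" "b < int k" using k by (auto simp: b_def)
    moreover have "finite {i. f i \<noteq> 0}" using v k by (simp add: fm mem_lamplighter_iff)
    ultimately have mem: "(?f, m - 1) \<in> carrier (lamplighter k)"
      using f k by (auto simp: mem_lamplighter_iff simp del: fun_upd_apply intro: finite_subset)
        (auto split: if_splits)
    have r: "r < k" by (simp add: r_def nat_k)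
    have "(b + int r) mod int k = f (m - 1)"
      using k f[of "m - 1"] by (simp add: r_def mod_simps)
    then have head: "head ?C ((?f, m - 1), lamp_gen r) = v"
      using k mem by (simp add: lamplighter_mult_gen fm)
    have "map (\<lambda>t. nat ((?f (m - 1 + int t) + ?f (m - 1 + int t - int N)) mod int k)) [0..<N] = w"
    proof (rule nth_equalityI)
      fix t assume "t < length (map (\<lambda>t. nat ((?f (m - 1 + int t) + ?f (m - 1 + int t - int N)) mod int k)) [0..<N])"
      then have t: "t < N" by simp
      show "map (\<lambda>t. nat ((?f (m - 1 + int t) + ?f (m - 1 + int t - int N)) mod int k)) [0..<N] ! t = w ! t"
      proof (cases t)
        case 0
        have "(b + f (m - 1 - int N)) mod int k = int (w ! 0)"
          using w'(2)[of 0] N by (simp add: b_def mod_simps)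
        then show ?thesis using 0 N by simp
      next
        case (Suc s)
        then have "w ! t = nat ((f (m + int s) + f (m + int s - int N)) mod int k)"
          using letter[of s] t w'(1) by (simp add: nth_append)
        then show ?thesis using Suc t by (simp add: algebra_simps)
      qed
    qed (simp add: w')
    moreover have "(m - 1) mod int M = i"
      using mod_pred_eq[OF lev i] by (simp add: mod_simps)
    moreover have "nat ((?f (m - 1 + int N) + b + int r) mod int k) = y"
    proof -
      have "(f (m - 1 + int N) + b + int r) mod int k =
          (f (m - 1 + int N) + b + (f (m - 1) - b)) mod int k"
        using k by (simp only: r_def mod_add_right_eq) (simp add: mod_add_right_eq)
      then have "(f (m - 1 + int N) + b + int r) mod int k = (f (m - 1 + int N) + f (m - 1)) mod int k"
        by simp
      moreover have "y = nat ((f (m - 1 + int N) + f (m - 1)) mod int k)"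
        using letter[of "N - 1"] N w'(1) by (simp add: nth_append of_nat_diff algebra_simps)
      ultimately show ?thesis using N by simp
    qed
    ultimately have "lamp_label k N M ((?f, m - 1), lamp_gen r) = e'"
      by (simp add: lamp_label_def lamp_word_def lamp_gen_def e'_eq)
    then show ?thesis
      using head lamp_cayley_arcI[OF k mem r] by (intro bexI[of _ "((?f, m - 1), lamp_gen r)"]) auto
  qed
qed (use lamp_word_hom[OF k] in blast)+

text \<open>Once the tail is known, the appended letter determines \<open>r\<close> modulo
  \<open>k\<close>, and \<open>r < k\<close>.\<close>

lemma lamp_label_inj:
  assumes k: "k \<ge> 2" and e: "e \<in> arcs (lamp_cayley k)" "e' \<in> arcs (lamp_cayley k)"
    and "tail (lamp_cayley k) e = tail (lamp_cayley k) e'" "lamp_label k N M e = lamp_label k N M e'"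
  shows "e = e'"
proof (rule lamp_cayley_arcE[OF k e(1)], rule lamp_cayley_arcE[OF k e(2)])
  fix f m r f' m' r'
  assume *: "e = ((f, m), lamp_gen r)" "r < k" "tail (lamp_cayley k) e = (f, m)"
    "e' = ((f', m'), lamp_gen r')" "r' < k" "tail (lamp_cayley k) e' = (f', m')"
  then have eq: "f' = f" "m' = m" using assms(4) by auto
  have "nat ((f (m + int N) + f m + int r) mod int k) = nat ((f (m + int N) + f m + int r') mod int k)"
    using assms(5) by (simp add: * eq lamp_label_def lamp_gen_def)
  moreover have "0 \<le> a mod int k" for a using k by simp
  ultimately have "(f (m + int N) + f m + int r) mod int k = (f (m + int N) + f m + int r') mod int k"
    by (metis nat_eq_iff2)
  then have "int r mod int k = int r' mod int k"
    by (metis add_diff_cancel_left' mod_diff_left_eq)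
  then show "e = e'" using * eq by simp
qed


section \<open>Convergence\<close>

definition has_period :: "nat \<Rightarrow> nat \<Rightarrow> nat list \<Rightarrow> bool" where
  "has_period d r x \<longleftrightarrow> (\<forall>u. r \<le> u \<and> u + d < length x - r \<longrightarrow> x ! u = x ! (u + d))"

text \<open>The first \<open>r + d\<close> letters determine the middle by periodicity. The last
  \<open>r\<close> letters are exempt from the period and have to be recorded as well, which makes
  \<open>2 * r + d\<close> letters in total.\<close>

lemma card_has_period:
  assumes N: "2 * r + d \<le> N" and d: "d \<ge> 1"
  shows "card {x \<in> words k N. has_period d r x} \<le> k ^ (2 * r + d)"
proof -
  let ?g = "\<lambda>x. take (r + d) x @ drop (N - r) x"
  have "inj_on ?g {x \<in> words k N. has_period d r x}"
  proof (rule inj_onI)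
    fix x y
    assume x: "x \<in> {x \<in> words k N. has_period d r x}"
      and y: "y \<in> {x \<in> words k N. has_period d r x}" and eq: "?g x = ?g y"
    have len: "length x = N" "length y = N" using x y by (auto simp: words_def)
    then have eq': "take (r + d) x = take (r + d) y" "drop (N - r) x = drop (N - r) y"
      using eq by (simp_all add: append_eq_append_conv)
    have "x ! u = y ! u" if "u < N" for u
      using that
    proof (induction u rule: less_induct)
      case (less u)
      consider "u < r + d" | "N - r \<le> u" | "r + d \<le> u" "u < N - r" by linarith
      then show ?case
      proof cases
        case 1
        then show ?thesis using eq'(1) by (metis nth_take)
      next
        case 2
        then have "drop (N - r) x ! (u - (N - r)) = drop (N - r) y ! (u - (N - r))"
          using eq'(2) by simp
        then show ?thesis using 2 less.prems len by simp
      next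
        case 3
        then have "x ! (u - d) = x ! u" "y ! (u - d) = y ! u"
          using x y len unfolding has_period_def
          by (auto dest!: spec[of _ "u - d"])
        moreover have "x ! (u - d) = y ! (u - d)" using 3 d less.prems by (intro less.IH) auto
        ultimately show ?thesis by simp
      qed
    qed
    then show "x = y" using len by (intro nth_equalityI) auto
  qed
  moreover have "?g ` {x \<in> words k N. has_period d r x} \<subseteq> words k (2 * r + d)"
  proof
    fix z assume "z \<in> ?g ` {x \<in> words k N. has_period d r x}"
    then obtain x where x: "x \<in> words k N" "z = ?g x" by blast
    then have "set z \<subseteq> set x" using set_take_subset[of "r + d" x] set_drop_subset[of "N - r" x] by auto
    then show "z \<in> words k (2 * r + d)" using x N by (auto simp: words_def)
  qed
  ultimately show ?thesis
    using card_inj_on_le[OF _ _ finite_words] by (metis card_words)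
qed

lemma lamp_word_nth:
  "t < N \<Longrightarrow>
     fst (lamp_word k N M (f, m)) ! t = nat ((f (m + int t) + f (m + int t - int N)) mod int k)"
  by (simp add: lamp_word_def)

text \<open>
  Distinct elements of the ball with the same word must sit at different levels, and then the
  letters of the word that no lamp in the ball affects would be periodic.
\<close>

lemma inj_on_lamp_word:
  assumes k: "k \<ge> 2" and N: "N \<ge> 2 * r" and x: "x \<in> words k N"
    and per: "M = 0 \<or> (\<forall>d. 1 \<le> d \<and> d \<le> 2 * r \<longrightarrow> \<not> has_period d r x)"
    and f0: "(f0, i) \<in> carrier (lamplighter k)" "lamp_word k N M (f0, i) = (x, i mod int M)"
  shows "inj_on (lamp_word k N M) (ball_verts (lamp_cayley k) (f0, i) r)"
proof -
  let ?B = "ball_verts (lamp_cayley k) (f0, i) r"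
  have B: "?B \<subseteq> carrier (lamplighter k)"
    using ball_verts_subset[OF wf_lamp_cayley[OF k], of "(f0, i)" r] f0(1) by simp
  \<comment> \<open>A letter at least \<open>r\<close> away from both ends reads the lamps at
    \<open>i + u\<close> and \<open>i + u - N\<close>, which no element of the ball has changed. So
    every word in the ball shows this letter, at a position shifted by the change of level.\<close>
  have middle: "x ! u = fst (lamp_word k N M (f, m)) ! nat (i + int u - m)"
      "0 \<le> i + int u - m" "i + int u - m < int N"
    if "(f, m) \<in> ?B" "r \<le> u" "u < N - r" for f m u
  proof -
    note b = lamp_cayley_ball[OF k that(1)]
    show ge: "0 \<le> i + int u - m" "i + int u - m < int N" using b(1) that(2,3) by linarith+
    have "x ! u = nat ((f0 (i + int u) + f0 (i + int u - int N)) mod int k)"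
      using lamp_word_nth[of u N k M f0 i] f0(2) that(3) by simp
    also have "\<dots> = nat ((f (i + int u) + f (i + int u - int N)) mod int k)"
    proof -
      have "i + int r \<le> i + int u" "i + int u - int N < i - int r" using that(2,3) by linarith+
      then show ?thesis using b(2)[of "i + int u"] b(2)[of "i + int u - int N"] by simp
    qed
    also have "\<dots> = fst (lamp_word k N M (f, m)) ! nat (i + int u - m)"
    proof -
      have t: "nat (i + int u - m) < N" and eq: "m + int (nat (i + int u - m)) = i + int u"
        using ge by linarith+
      show ?thesis using lamp_word_nth[OF t, of k M f m] unfolding eq by simp
    qed
    finally show "x ! u = fst (lamp_word k N M (f, m)) ! nat (i + int u - m)" .
  qed
  \<comment> \<open>A common word read at levels \<open>m < m'\<close> shows each middle letter of
    \<open>x\<close> at two places, so the middle of \<open>x\<close> has period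
    \<open>m' - m\<close>. For \<open>M = 0\<close> equal images already have equal levels.\<close>
  have lt: "\<not> m < m'"
    if ball: "(f, m) \<in> ?B" "(f', m') \<in> ?B" and eq: "lamp_word k N M (f, m) = lamp_word k N M (f', m')"
    for f f' m m'
  proof
    assume less: "m < m'"
    have "m mod int M = m' mod int M" using eq by (simp add: lamp_word_def)
    then have "M \<noteq> 0" using less by (metis mod_by_0 of_nat_0 less_irrefl)
    let ?d = "nat (m' - m)"
    have d: "1 \<le> ?d" "?d \<le> 2 * r"
      using less lamp_cayley_ball(1)[OF k ball(1)] lamp_cayley_ball(1)[OF k ball(2)] by linarith+
    have "has_period ?d r x"
      unfolding has_period_def
    proof (intro allI impI)
      fix u assume u: "r \<le> u \<and> u + ?d < length x - r"
      moreover have "length x = N" using x by (simp add: words_def)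
      ultimately have u: "r \<le> u" "u < N - r" "r \<le> u + ?d" "u + ?d < N - r" by auto
      have shift: "i + int (u + ?d) - m' = i + int u - m" using less by simp
      show "x ! u = x ! (u + ?d)"
        unfolding middle(1)[OF ball(1) u(1,2)] middle(1)[OF ball(2) u(3,4)] eq shift by (rule refl)
    qed
    then show False using per d \<open>M \<noteq> 0\<close> by blast
  qed
  show ?thesis
  proof (rule inj_onI)
    fix v v' assume v: "v \<in> ?B" "v' \<in> ?B" "lamp_word k N M v = lamp_word k N M v'"
    obtain f m f' m' where fm: "v = (f, m)" "v' = (f', m')" by (cases v, cases v')
    then have [simp]: "m' = m" using lt v by (metis linorder_less_linear)
    note b = lamp_cayley_ball[OF k v(1)[unfolded fm]]
    note b' = lamp_cayley_ball[OF k v(2)[unfolded fm]]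
    have "(f, m) \<in> carrier (lamplighter k)" "(f', m) \<in> carrier (lamplighter k)"
      using v B fm by auto
    then have bnd: "0 \<le> f j" "f j < int k" "0 \<le> f' j" "f' j < int k" for j
      using k by (simp_all add: mem_lamplighter_iff)
    have letters: "(f (m + t) + f (m + t - int N)) mod int k = (f' (m + t) + f' (m + t - int N)) mod int k"
      if "0 \<le> t" "t < int N" for t
    proof -
      have t: "nat t < N" "int (nat t) = t" using that by linarith+
      then have "nat ((f (m + t) + f (m + t - int N)) mod int k) =
          nat ((f' (m + t) + f' (m + t - int N)) mod int k)"
        using lamp_word_nth[OF t(1), of k M f m] lamp_word_nth[OF t(1), of k M f' m] v(3) fm
        unfolding t(2) by simp
      moreover have "0 \<le> a mod int k" for a using k by simp
      ultimately show ?thesis by (metis nat_eq_iff2)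
    qed
    \<comment> \<open>At equal levels, each lamp that the ball can change occurs in a letter of the
      word: letter \<open>j\<close> if \<open>m \<le> j\<close>, letter \<open>j + N\<close>
      otherwise. Because \<open>N \<ge> 2 * r\<close>, the other lamp in that letter is unchanged,
      so the letter determines this one.\<close>
    have "f j = f' j" for j
    proof -
      consider "j < i - int r \<or> i + int r \<le> j" | "m \<le> j" "j < i + int r" | "i - int r \<le> j" "j < m"
        by linarith
      then show ?thesis
      proof cases
        case 1
        then show ?thesis using b(2) b'(2) by simp
      next
        case 2
        have "f (j - int N) = f' (j - int N)" using b(2) b'(2) 2 N by simp
        then have "f j mod int k = f' j mod int k"
          using letters[of "j - m"] 2 N b(1) by (simp add: mod_eq_dvd_iff)
        then show ?thesis using bnd[of j] by simp
      next
        case 3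
        have "f (j + int N) = f' (j + int N)" using b(2) b'(2) 3 N by simp
        then have "f j mod int k = f' j mod int k"
          using letters[of "j + int N - m"] 3 N b(1) by (simp add: mod_eq_dvd_iff)
        then show ?thesis using bnd[of j] by simp
      qed
    qed
    then show "v = v'" using fm by auto
  qed
qed

section \<open>Finite spider-web graphs with growing word length\<close>

lemma balls_iso_lamp_cayley:
  assumes k: "k \<ge> 2" and N: "N \<ge> 1" "N \<ge> 2 * r" and x: "x \<in> words k N" "i mod int M = i"
    and per: "M = 0 \<or> (\<forall>d. 1 \<le> d \<and> d \<le> 2 * r \<longrightarrow> \<not> has_period d r x)"
    and w: "w \<in> verts (lamp_cayley k)"
  shows "balls_iso (spider_web k N (enat M)) (x, i) (lamp_cayley k) w r"
proof -
  obtain f0 where f0: "(f0, i) \<in> carrier (lamplighter k)" "lamp_word k N M (f0, i) = (x, i)"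
    using lamp_word_surj[of k x N i M] k x by auto
  have "balls_iso (lamp_cayley k) (f0, i) (spider_web k N (enat M)) (lamp_word k N M (f0, i)) r"
    using f0 x by (intro fibration_balls_iso[OF fibration_lamp_word[OF k N(1)] wf_lamp_cayley[OF k]]
        inj_on_lamp_word[OF k N(2) x(1) per] lamp_label_inj[OF k]) auto
  then show ?thesis
    using transitive_graph_balls_iso[OF transitive_lamp_cayley[OF k], of "(f0, i)" w r] f0 w
    by (metis balls_iso_sym balls_iso_trans cayley_graph_sel(1))
qed

text \<open>The number of levels cancels in the proportion of bad roots, so the bound depends on
  \<open>N\<close> alone. A general filter allows \<open>M\<close> to be fixed or to grow together
  with \<open>N\<close>.\<close>

lemma bs_converges_spider_web_lamp_cayley:
  assumes k: "k \<ge> 2" and N: "filterlim N at_top F" and M: "\<forall>\<^sub>F i in F. M i \<ge> 1"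
  shows "bs_converges (\<lambda>i. spider_web k (N i) (enat (M i))) (lamp_cayley k) F"
proof (rule bs_converges_finite[OF transitive_lamp_cayley[OF k]])
  let ?G = "\<lambda>i. spider_web k (N i) (enat (M i))" and ?w = "((\<lambda>_. 0), 0) :: (int \<Rightarrow> int) \<times> int"
  show w: "?w \<in> verts (lamp_cayley k)" using k by (simp add: zero_lamplighter)
  show "\<forall>\<^sub>F i in F. fin_digraph (?G i) \<and> verts (?G i) \<noteq> {}"
    using M
  proof eventually_elim
    case (elim i)
    have "(replicate (N i) 0, 0) \<in> verts (?G i)" using k by (simp add: replicate_in_words)
    moreover have "fin_digraph (?G i)" using elim by (intro fin_digraph_spider_web) simp
    ultimately show ?case by (metis empty_iff)
  qed
  fix r
  let ?bad = "\<lambda>i. {v \<in> verts (?G i). \<not> balls_iso (?G i) v (lamp_cayley k) ?w r}"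
  let ?c = "real (2 * r) * real k ^ (4 * r)"
  have "((\<lambda>n. (1 / real k) ^ n) \<longlonglongrightarrow> 0)" using k by (intro LIMSEQ_power_zero) simp
  then have "((\<lambda>i. ?c * (1 / real k) ^ N i) \<longlongrightarrow> ?c * 0) F"
    using N by (intro tendsto_mult_left) (rule filterlim_compose)
  then have lim: "((\<lambda>i. ?c * (1 / real k) ^ N i) \<longlongrightarrow> 0) F" by simp
  show "((\<lambda>i. real (card (?bad i)) / real (card (verts (?G i)))) \<longlongrightarrow> 0) F"
  proof (rule tendsto_sandwich[OF _ _ tendsto_const lim])
    \<comment> \<open>From here on \<open>2 * r + d \<le> N i\<close> for every period
      \<open>d \<le> 2 * r\<close>, as \<open>card_has_period\<close> demands.\<close>
    have "\<forall>\<^sub>F i in F. N i \<ge> 4 * r + 1" using N by (simp add: filterlim_at_top)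
    then show "\<forall>\<^sub>F i in F. real (card (?bad i)) / real (card (verts (?G i))) \<le> ?c * (1 / real k) ^ N i"
      using M
    proof eventually_elim
      case (elim i)
      let ?P = "\<lambda>d. {x \<in> words k (N i). has_period d r x}"
      \<comment> \<open>Whether a root is bad is controlled by its word, whatever its level.\<close>
      have "?bad i \<subseteq> (\<Union>d \<in> {1..2 * r}. ?P d) \<times> {0..<int (M i)}"
      proof
        fix v assume v: "v \<in> ?bad i"
        obtain x j where xj: "v = (x, j)" "x \<in> words k (N i)" "j mod int (M i) = j"
          using v by (cases v) auto
        have "\<exists>d. 1 \<le> d \<and> d \<le> 2 * r \<and> has_period d r x"
          using balls_iso_lamp_cayley[OF k _ _ xj(2,3) _ w, of r] v xj(1) elim by auto
        then show "v \<in> (\<Union>d \<in> {1..2 * r}. ?P d) \<times> {0..<int (M i)}"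
          using xj elim levels_eq[of "M i"] by auto
      qed
      then have "card (?bad i) \<le> card ((\<Union>d \<in> {1..2 * r}. ?P d) \<times> {0..<int (M i)})"
        by (intro card_mono) (auto simp: finite_words)
      also have "\<dots> = card (\<Union>d \<in> {1..2 * r}. ?P d) * M i" by (simp add: card_cartesian_product)
      also have "card (\<Union>d \<in> {1..2 * r}. ?P d) \<le> (\<Sum>d \<in> {1..2 * r}. card (?P d))"
        by (rule card_UN_le) simp
      also have "\<dots> \<le> (\<Sum>d \<in> {1..2 * r}. k ^ (4 * r))"
      proof (rule sum_mono)
        fix d assume d: "d \<in> {1..2 * r}"
        then have "card (?P d) \<le> k ^ (2 * r + d)" using elim by (intro card_has_period) auto
        also have "\<dots> \<le> k ^ (4 * r)" using d k by (intro power_increasing) auto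
        finally show "card (?P d) \<le> k ^ (4 * r)" .
      qed
      finally have "card (?bad i) \<le> 2 * r * k ^ (4 * r) * M i" by simp
      then have "real (card (?bad i)) \<le> real (2 * r * k ^ (4 * r) * M i)"
        by (simp only: of_nat_le_iff)
      then have "real (card (?bad i)) \<le> ?c * real (M i)" by simp
      moreover have "card (verts (?G i)) = k ^ N i * M i"
        using elim by (simp add: levels_eq card_cartesian_product card_words)
      ultimately show ?case using k elim by (simp add: field_simps power_divide)
    qed
  qed simp
qed

section \<open>The infinite spider-web graphs and the limit in \<open>M\<close>\<close>

lemma transitive_spider_web_infinity:
  assumes k: "k \<ge> 2"
  shows "transitive_graph (spider_web k N (enat 0))"
proof -
  let ?G = "spider_web k N (enat 0)"
  \<comment> \<open>Letter \<open>t\<close> of a word at level \<open>j\<close> is given the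
    absolute position \<open>j + t\<close>, which it keeps along an arc, while the appended letter
    gets position \<open>j + N\<close>. Hence adding a function \<open>a\<close> of the absolute
    position, followed by a translation of levels by \<open>s\<close>, respects the arcs.\<close>
  define T :: "(int \<Rightarrow> int) \<Rightarrow> int \<Rightarrow> nat list \<times> int \<Rightarrow> nat list \<times> int" where
    "T a s = (\<lambda>(x, j). (map (\<lambda>t. nat ((int (x ! t) + a (j + int t)) mod int k)) [0..<N], j + s))" for a s
  define E :: "(int \<Rightarrow> int) \<Rightarrow> int \<Rightarrow> (nat list \<times> int) \<times> nat \<Rightarrow> (nat list \<times> int) \<times> nat" where
    "E a s = (\<lambda>((x, j), y). (T a s (x, j), nat ((int y + a (j + int N)) mod int k)))" for a s
  have nat_k: "nat (z mod int k) < k" and nonneg: "0 \<le> z mod int k" for z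
    using k by (simp_all add: nat_less_iff)
  have T: "T a s ` verts ?G \<subseteq> verts ?G" and E: "E a s ` arcs ?G \<subseteq> arcs ?G" for a s
    by (auto simp: T_def E_def words_def nat_k)
  have T_inv: "T b (- s) (T a s v) = v" if v_G: "v \<in> verts ?G" and b: "\<And>j. b (j + s) = - a j" for a b s v
  proof -
    obtain x j where v: "v = (x, j)" "length x = N" "\<And>t. t < N \<Longrightarrow> x ! t < k"
      using v_G by (auto simp: words_def subset_iff)
    have "b (j + s + int t) = - a (j + int t)" for t
      using b[of "j + int t"] by (simp add: algebra_simps)
    then show ?thesis using v by (auto simp: T_def nonneg mod_simps intro!: nth_equalityI)
  qed
  have E_inv: "E b (- s) (E a s e) = e" if e: "e \<in> arcs ?G" and b: "\<And>j. b (j + s) = - a j" for a b s e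
  proof -
    obtain x j y where xy: "e = ((x, j), y)" "(x, j) \<in> verts ?G" "y < k" using e by auto
    have "b (j + s + int N) = - a (j + int N)"
      using b[of "j + int N"] by (simp add: algebra_simps)
    moreover have "snd (T a s (x, j)) = j + s" by (simp add: T_def)
    ultimately show ?thesis
      using T_inv[of "(x, j)" b s a] b xy
      by (cases "T a s (x, j)") (simp add: E_def nonneg mod_simps)
  qed
  have "rooted_iso ?G v ?G w" if vw: "v \<in> verts ?G" "w \<in> verts ?G" for v w
  proof -
    obtain x i x' i' where vw_eq: "v = (x, i)" "w = (x', i')" by (cases v, cases w)
    have x: "length x = N" "length x' = N" "\<And>t. t < N \<Longrightarrow> x' ! t < k"
      using vw by (auto simp: vw_eq words_def subset_iff)
    \<comment> \<open>The words \<open>x\<close> and \<open>x'\<close> prescribe \<open>a\<close>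
      only at the positions \<open>i\<close> to \<open>i + N - 1\<close>; its values elsewhere are
      arbitrary.\<close>
    define a where "a j = int (x' ! nat (j - i)) - int (x ! nat (j - i))" for j
    define s where "s = i' - i"
    \<comment> \<open>Translation by \<open>s\<close> also moves the absolute positions, so the
      inverse map has to subtract \<open>a\<close> at the position before the translation.\<close>
    define b where "b j = - a (j - s)" for j
    have ab: "b (j + s) = - a j" "a (j + - s) = - b j" for j by (simp_all add: b_def)
    have "bij_betw (T a s) (verts ?G) (verts ?G)"
      using T_inv[of _ b s a] T_inv[of _ a "- s" b] ab T
      by (intro bij_betw_byWitness[where f' = "T b (- s)"]) auto
    moreover have "bij_betw (E a s) (arcs ?G) (arcs ?G)"
      using E_inv[of _ b s a] E_inv[of _ a "- s" b] ab E
      by (intro bij_betw_byWitness[where f' = "E b (- s)"]) auto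
    moreover have "T a s (tail ?G e) = tail ?G (E a s e) \<and> T a s (head ?G e) = head ?G (E a s e)"
      if e_G: "e \<in> arcs ?G" for e
    proof -
      obtain z j y where e: "e = ((z, j), y)" "length z = N"
        using e_G by (auto simp: words_def)
      let ?z = "map (\<lambda>t. nat ((int (z ! t) + a (j + int t)) mod int k)) [0..<N]"
      let ?y = "nat ((int y + a (j + int N)) mod int k)"
      have "map (\<lambda>t. nat ((int (tl (z @ [y]) ! t) + a (j + 1 + int t)) mod int k)) [0..<N] = tl (?z @ [?y])"
      proof (rule nth_equalityI)
        fix t assume "t < length (map (\<lambda>t. nat ((int (tl (z @ [y]) ! t) + a (j + 1 + int t)) mod int k)) [0..<N])"
        then have t: "t < N" by simp
        show "map (\<lambda>t. nat ((int (tl (z @ [y]) ! t) + a (j + 1 + int t)) mod int k)) [0..<N] ! t = tl (?z @ [?y]) ! t"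
        proof (cases "Suc t < N")
          case True
          then show ?thesis using t e by (simp add: nth_tl nth_append algebra_simps)
        next
          case False
          then have "N = Suc t" using t by simp
          then show ?thesis using e by (simp add: nth_tl nth_append algebra_simps)
        qed
      qed simp
      then show ?thesis by (simp add: e T_def E_def)
    qed
    moreover have "T a s v = w"
      using x by (auto simp: T_def a_def s_def vw_eq intro!: nth_equalityI)
    ultimately have "iso_maps (T a s) (E a s) ?G v ?G w" by (auto simp: iso_maps_def)
    then show ?thesis using wf_spider_web by (auto simp: rooted_iso_iff)
  qed
  then show ?thesis
    using wf_spider_web locally_finite_spider_web connected_spider_web[OF k]
    by (auto simp: transitive_graph_def)
qed

lemma spider_web_infinity_level:
  assumes "(y, j) \<in> ball_verts (spider_web k N (enat 0)) (x, i) r"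
  shows "\<bar>j - i\<bar> \<le> int r"
  using assms
proof (induction r arbitrary: y j)
  case (Suc r)
  then obtain z l where z: "(z, l) \<in> ball_verts (spider_web k N (enat 0)) (x, i) r" "\<bar>j - l\<bar> \<le> 1"
    by (fastforce simp: ball_verts_Suc adj_iff)
  then show ?case using Suc.IH[of z l] by linarith
qed simp

lemma fibration_spider_web_infinity:
  "fibration (\<lambda>(x, i). (x, i mod int M)) (\<lambda>((x, i), y). ((x, i mod int M), y))
     (spider_web k N (enat 0)) (spider_web k N (enat M))"
  unfolding fibration_def
proof (intro conjI ballI impI)
  let ?G = "spider_web k N (enat 0)" and ?H = "spider_web k N (enat M)"
  let ?f = "\<lambda>(x :: nat list, i). (x, i mod int M)"
    and ?g = "\<lambda>((x :: nat list, i), y :: nat). ((x, i mod int M), y)"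
  fix v e' assume v: "v \<in> verts ?G" and e': "e' \<in> arcs ?H"
  obtain x i where vx: "v = (x, i)" by (cases v)
  obtain x' j y where e'_eq: "e' = ((x', j), y)" "x' \<in> words k N" "j mod int M = j" "y < k"
    using e' by auto
  show "\<exists>e \<in> arcs ?G. ?g e = e' \<and> tail ?G e = v" if "tail ?H e' = ?f v"
    using that e'_eq vx by (intro bexI[of _ "((x', i), y)"]) auto
  show "\<exists>e \<in> arcs ?G. ?g e = e' \<and> head ?G e = v" if hd: "head ?H e' = ?f v"
  proof -
    have "j = (i - 1) mod int M"
      using mod_pred_eq[of j "int M" "i mod int M"] hd e'_eq vx by (simp add: mod_simps)
    then show ?thesis using hd e'_eq vx by (intro bexI[of _ "((x', i - 1), y)"]) auto
  qed
qed (auto simp: mod_simps)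

text \<open>Two levels in an \<open>r\<close>-ball of the infinite graph differ by at most
  \<open>2 * r\<close>, so reduction modulo a larger \<open>M\<close> keeps them apart.\<close>

lemma balls_iso_spider_web_infinity:
  assumes k: "k \<ge> 2" and M: "M > 2 * r" and v: "v \<in> verts (spider_web k N (enat M))"
    and w: "w \<in> verts (spider_web k N (enat 0))"
  shows "balls_iso (spider_web k N (enat M)) v (spider_web k N (enat 0)) w r"
proof -
  let ?G = "spider_web k N (enat 0)" and ?f = "\<lambda>(x :: nat list, i). (x, i mod int M)"
  obtain x i where vx: "v = (x, i)" "(x, i) \<in> verts ?G" "?f (x, i) = v" using v by auto
  have "inj_on ?f (ball_verts ?G (x, i) r)"
  proof (rule inj_onI, clarsimp)
    fix y j j' assume *: "(y, j) \<in> ball_verts ?G (x, i) r" "(y, j') \<in> ball_verts ?G (x, i) r"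
      "j mod int M = j' mod int M"
    then have "\<bar>j - j'\<bar> < int M"
      using spider_web_infinity_level[OF *(1)] spider_web_infinity_level[OF *(2)] M by linarith
    moreover have "int M dvd j - j'" using *(3) by (simp add: mod_eq_dvd_iff)
    ultimately show "j = j'" using dvd_imp_le_int[of "j - j'" "int M"] by force
  qed
  then have "balls_iso ?G (x, i) (spider_web k N (enat M)) (?f (x, i)) r"
    by (intro fibration_balls_iso[OF fibration_spider_web_infinity wf_spider_web vx(2)]) auto
  then show ?thesis
    using transitive_graph_balls_iso[OF transitive_spider_web_infinity[OF k] vx(2) w, of r] vx(3)
    by (metis balls_iso_sym balls_iso_trans)
qed

lemma bs_converges_spider_web_infinity:
  assumes k: "k \<ge> 2"
  shows "bs_converges (\<lambda>M. spider_web k N (enat M)) (spider_web k N \<infinity>) sequentially"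
  unfolding spider_web_infinity
proof (rule bs_converges_finite[OF transitive_spider_web_infinity[OF k]])
  let ?w = "(replicate N 0, 0 :: int)"
  have w: "?w \<in> verts (spider_web k N (enat M))" for M using k by (simp add: replicate_in_words)
  show "?w \<in> verts (spider_web k N (enat 0))" by (rule w)
  show "\<forall>\<^sub>F M in sequentially. fin_digraph (spider_web k N (enat M)) \<and> verts (spider_web k N (enat M)) \<noteq> {}"
    \<comment> \<open>The value \<open>M = 0\<close> must be excluded, since it encodes the infinite
      graph.\<close>
    using eventually_gt_at_top[of 0] by eventually_elim (use w fin_digraph_spider_web in blast)
  fix r
  show "((\<lambda>M. real (card {v \<in> verts (spider_web k N (enat M)).
        \<not> balls_iso (spider_web k N (enat M)) v (spider_web k N (enat 0)) ?w r}) /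
      real (card (verts (spider_web k N (enat M))))) \<longlonglongrightarrow> 0)"
  \<comment> \<open>No root is bad once \<open>M > 2 * r\<close>.\<close>
  proof (rule tendsto_eventually)
    show "\<forall>\<^sub>F M in sequentially. real (card {v \<in> verts (spider_web k N (enat M)).
        \<not> balls_iso (spider_web k N (enat M)) v (spider_web k N (enat 0)) ?w r}) /
      real (card (verts (spider_web k N (enat M)))) = 0"
      using eventually_gt_at_top[of "2 * r"]
    proof eventually_elim
      case (elim M)
      then have "{v \<in> verts (spider_web k N (enat M)).
          \<not> balls_iso (spider_web k N (enat M)) v (spider_web k N (enat 0)) ?w r} = {}"
        using balls_iso_spider_web_infinity[OF k elim _ w] by blast
      then show ?case by (simp only: card.empty of_nat_0 div_0)
    qed
  qed
qed

section \<open>Limits of the infinite graphs\<close>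

lemma infinite_times_int: "x \<in> A \<Longrightarrow> infinite (A \<times> (UNIV :: int set))"
  by (auto simp: finite_cartesian_product_iff infinite_UNIV_int)

text \<open>For infinitely many levels \<open>balls_iso_lamp_cayley\<close> puts no condition on the
  word, so even the constant word, which has every period, serves as root.\<close>

lemma bs_converges_spider_web_infinity_lamp_cayley:
  assumes k: "k \<ge> 2"
  shows "bs_converges (\<lambda>N. spider_web k N \<infinity>) (lamp_cayley k) sequentially"
  unfolding spider_web_infinity
proof (rule bs_converges_transitive[OF transitive_lamp_cayley[OF k]])
  let ?w = "((\<lambda>_. 0), 0) :: (int \<Rightarrow> int) \<times> int"
  show w: "?w \<in> verts (lamp_cayley k)" using k by (simp add: zero_lamplighter)
  have "infinite (verts (spider_web k N (enat 0)))" for N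
    using infinite_times_int[OF replicate_in_words[of k N]] k by simp
  then show "\<forall>\<^sub>F N in sequentially.
      transitive_graph (spider_web k N (enat 0)) \<and> infinite (verts (spider_web k N (enat 0)))"
    using transitive_spider_web_infinity[OF k] by simp
  fix r
  show "\<forall>\<^sub>F N in sequentially. \<exists>v \<in> verts (spider_web k N (enat 0)).
      balls_iso (spider_web k N (enat 0)) v (lamp_cayley k) ?w r"
    using eventually_ge_at_top[of "2 * r + 1"]
  proof eventually_elim
    case (elim N)
    have x: "replicate N 0 \<in> words k N" using k by (intro replicate_in_words) simp
    then have "balls_iso (spider_web k N (enat 0)) (replicate N 0, 0) (lamp_cayley k) ?w r"
      using elim by (intro balls_iso_lamp_cayley[OF k _ _ x _ _ w]) auto
    then show ?case using x by (intro bexI[of _ "(replicate N 0, 0)"]) auto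
  qed
qed

text \<open>This closes the diagram: after the limit in \<open>N\<close> for each fixed
  \<open>M\<close>, the limit in \<open>M\<close> is that of a constant sequence.\<close>

lemma bs_converges_lamp_cayley_const:
  assumes k: "k \<ge> 2"
  shows "bs_converges (\<lambda>_. lamp_cayley k) (lamp_cayley k) F"
proof (rule bs_converges_transitive[OF transitive_lamp_cayley[OF k]])
  let ?w = "((\<lambda>_. 0), 0) :: (int \<Rightarrow> int) \<times> int"
  show w: "?w \<in> verts (lamp_cayley k)" using k by (simp add: zero_lamplighter)
  have "(\<lambda>_. 0) \<in> carrier (lamp_configs k)" using w by (simp add: lamplighter_def)
  then have "infinite (verts (lamp_cayley k))"
    using infinite_times_int[of "\<lambda>_. 0" "carrier (lamp_configs k)"] by (simp add: lamplighter_def)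
  then show "\<forall>\<^sub>F _ in F. transitive_graph (lamp_cayley k) \<and> infinite (verts (lamp_cayley k))"
    using transitive_lamp_cayley[OF k] by simp
  show "\<forall>\<^sub>F _ in F. \<exists>v \<in> verts (lamp_cayley k). balls_iso (lamp_cayley k) v (lamp_cayley k) ?w r" for r
    by (intro always_eventually allI bexI[OF _ w] transitive_graph_balls_iso transitive_lamp_cayley k w)
qed

section \<open>The diagram of limits\<close>

theorem theorem4p17:
  fixes k :: nat
  assumes "k \<ge> 2"
  shows "bs_converges (\<lambda>N. de_bruijn k N) (cayley_graph (lamplighter k) (lamp_gens k)) sequentially
    \<and> (\<forall>M::nat. M \<ge> 1 \<longrightarrow>
         bs_converges (\<lambda>N. spider_web k N (enat M))
           (cayley_graph (lamplighter k) (lamp_gens k)) sequentially)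
    \<and> (\<forall>N. bs_converges (\<lambda>M. spider_web k N (enat M)) (spider_web k N \<infinity>) sequentially)
    \<and> bs_converges (\<lambda>N. spider_web k N \<infinity>)
         (cayley_graph (lamplighter k) (lamp_gens k)) sequentially
    \<and> bs_converges (\<lambda>M::nat. cayley_graph (lamplighter k) (lamp_gens k))
         (cayley_graph (lamplighter k) (lamp_gens k)) sequentially
    \<and> bs_converges (\<lambda>(N, M). spider_web k N (enat M))
         (cayley_graph (lamplighter k) (lamp_gens k)) (sequentially \<times>\<^sub>F sequentially)"
proof (intro conjI allI impI)
  note sw = bs_converges_spider_web_lamp_cayley[OF assms]
  show sw_fixed: "bs_converges (\<lambda>N. spider_web k N (enat M)) (lamp_cayley k) sequentially" if "M \<ge> 1" for M
    using that by (intro sw filterlim_ident) simp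
  from this[of 1] show "bs_converges (\<lambda>N. de_bruijn k N) (lamp_cayley k) sequentially"
    by (simp add: de_bruijn_def one_enat_def)
  \<comment> \<open>In the joint limit \<open>sw\<close> requires only that \<open>M\<close> is
    eventually positive.\<close>
  have "\<forall>\<^sub>F p in sequentially \<times>\<^sub>F sequentially. (snd p :: nat) \<ge> 1"
    using filterlim_snd[of sequentially sequentially] by (simp add: filterlim_at_top)
  from sw[OF filterlim_fst this]
  show "bs_converges (\<lambda>(N, M). spider_web k N (enat M)) (lamp_cayley k) (sequentially \<times>\<^sub>F sequentially)"
    by (simp add: case_prod_unfold)
qed (fact bs_converges_spider_web_infinity[OF assms] bs_converges_lamp_cayley_const[OF assms]
    bs_converges_spider_web_infinity_lamp_cayley[OF assms])+

end
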